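(* Let $(\mathscr{H},d)$ be a Polish metric space of diameter at most $1$, let $T=(V,E)$ be a finite rooted tree with $n$ vertices, let $b\in[0,1)$, and let $\nu\in\mathrm{Prob}(\mathscr{H}^V)$ be an $\mathscr{H}$-valued Markov measure indexed by $T$ with $b$-Lipschitz transition kernels. Let $\Delta=\Delta(T,b)$ be the $\ell^2(V)$-norm of the descendant generating function of $T$. Then for every $f\colon\mathscr{H}^V\to\mathbb{R}$ which is $1$-Lipschitz with respect to the normalized Hamming metric and satisfies $\int f\,d\nu=0$, and every $\lambda\in\mathbb{R}$, \[ \int e^{n\lambda f}\,d\nu\le e^{\lambda^2\Delta^2/8}. \] Equivalently, \[ \bar d(\mu,\nu)\le\frac{\Delta}{n}\sqrt{\tfrac12 D(\mu\|\nu)}\qquad\text{for all }\mu\in\mathrm{Prob}(\mathscr{H}^V). \]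
   Context: $\mathrm{Prob}(X)$ is the set of Borel probability measures on $X$. For a finite set $V$, the normalized Hamming metric on $\mathscr{H}^V$ is $d(x,y)=\frac1{|V|}\sum_{v\in V}d(x_v,y_v)$. The transportation metric on $\mathrm{Prob}(\mathscr{H}^V)$ is $\bar d(\mu,\nu)=\inf_\lambda\int d(x,y)\,d\lambda(x,y)$, the infimum being over couplings $\lambda$ of $\mu$ and $\nu$; $\bar d$ on $\mathrm{Prob}(\mathscr{H})$ is the case $|V|=1$. Relative entropy: $D(\mu\|\nu)=\int\log\frac{d\mu}{d\nu}\,d\mu$ if $\mu\ll\nu$, and $+\infty$ otherwise. Trees: $T$ has root $\rho$; $\pi(v)$ is the parent of a non-root vertex $v$; $d(v,w)$ is the graph distance; $v\le w$ means that $v$ lies on the simple path from $\rho$ to $w$ (endpoints included); $D_r(v)=\{w\in V: v\le w,\ d(v,w)=r\}$. Markov measure indexed by $T$: let $r$ be the depth of $T$ and $L_k$ the set of vertices at distance $k$ from $\rho$. Given $\nu_\rho\in\mathrm{Prob}(\mathscr{H})$ and probability kernels $q_v\colon\mathscr{H}\to\mathrm{Prob}(\mathscr{H})$ for $v\in V\setminus\{\rho\}$, the associated Markov measure is the $\nu\in\mathrm{Prob}(\mathscr{H}^V)$ given by \[\nu(A)=\int_{\mathscr{H}^{L_0}}\int_{\mathscr{H}^{L_1}}\cdots\int_{\mathscr{H}^{L_r}}\mathbf 1_A(y)\prod_{v\in L_r}q_v(dy_v|y_{\pi(v)})\cdots\prod_{v\in L_1}q_v(dy_v|y_\rho)\,\nu_\rho(dy_\rho)\]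 for Borel $A\subseteq\mathscr{H}^V$. It is $b$-Lipschitz if each kernel $q_v$ is $b$-Lipschitz as a map $(\mathscr{H},d)\to(\mathrm{Prob}(\mathscr{H}),\bar d)$. Descendant generating function: $\delta(v)=\sum_{r=0}^\infty|D_r(v)|\,b^r$ for $v\in V$ (with $b^0=1$, also when $b=0$), and $\Delta=\big(\sum_{v\in V}\delta(v)^2\big)^{1/2}$. *)

theory Defs
  imports "HOL-Probability.Probability"
begin

section \<open>Finite rooted trees\<close>

text \<open>
  Graphs are undirected and simple: an edge is a two-element set of vertices.
  (The notion of a tree in the AFP entry \<open>Graph_Theory\<close> only excludes directed cycles, so that an
  orientation of an undirected cycle is a tree there.)
\<close>

definition walk :: "'v set \<Rightarrow> 'v set set \<Rightarrow> 'v \<Rightarrow> 'v list \<Rightarrow> 'v \<Rightarrow> bool" where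
  "walk V E u p w \<longleftrightarrow>
     p \<noteq> [] \<and> set p \<subseteq> V \<and> hd p = u \<and> last p = w \<and> successively (\<lambda>x y. {x, y} \<in> E) p"

definition simple_path :: "'v set \<Rightarrow> 'v set set \<Rightarrow> 'v \<Rightarrow> 'v list \<Rightarrow> 'v \<Rightarrow> bool" where
  "simple_path V E u p w \<longleftrightarrow> walk V E u p w \<and> distinct p"

definition is_cycle :: "'v set \<Rightarrow> 'v set set \<Rightarrow> 'v list \<Rightarrow> bool" where
  "is_cycle V E p \<longleftrightarrow>
     length p \<ge> 3 \<and> set p \<subseteq> V \<and> distinct p \<and> successively (\<lambda>x y. {x, y} \<in> E) p \<and>
     {last p, hd p} \<in> E"

definition finite_rooted_tree :: "'v set \<Rightarrow> 'v set set \<Rightarrow> 'v \<Rightarrow> bool" where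
  "finite_rooted_tree V E \<rho> \<longleftrightarrow>
     finite V \<and> \<rho> \<in> V \<and>
     (\<forall>e\<in>E. \<exists>u\<in>V. \<exists>w\<in>V. u \<noteq> w \<and> e = {u, w}) \<and>
     (\<forall>u\<in>V. \<forall>w\<in>V. \<exists>p. walk V E u p w) \<and>
     (\<nexists>p. is_cycle V E p)"

definition graph_dist :: "'v set \<Rightarrow> 'v set set \<Rightarrow> 'v \<Rightarrow> 'v \<Rightarrow> nat" where
  "graph_dist V E u w = (LEAST k. \<exists>p. walk V E u p w \<and> length p = Suc k)"

text \<open>In a tree the simple path from the root to \<open>w\<close> exists and is unique.\<close>

definition tree_le :: "'v set \<Rightarrow> 'v set set \<Rightarrow> 'v \<Rightarrow> 'v \<Rightarrow> 'v \<Rightarrow> bool" where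
  "tree_le V E \<rho> v w \<longleftrightarrow> (\<exists>p. simple_path V E \<rho> p w \<and> v \<in> set p)"

definition parent :: "'v set \<Rightarrow> 'v set set \<Rightarrow> 'v \<Rightarrow> 'v \<Rightarrow> 'v" where
  "parent V E \<rho> v = (THE u. {u, v} \<in> E \<and> tree_le V E \<rho> u v)"

definition layer :: "'v set \<Rightarrow> 'v set set \<Rightarrow> 'v \<Rightarrow> nat \<Rightarrow> 'v set" where
  "layer V E \<rho> k = {v \<in> V. graph_dist V E \<rho> v = k}"

definition tree_depth :: "'v set \<Rightarrow> 'v set set \<Rightarrow> 'v \<Rightarrow> nat" where
  "tree_depth V E \<rho> = Max (graph_dist V E \<rho> ` V)"

definition descendants :: "'v set \<Rightarrow> 'v set set \<Rightarrow> 'v \<Rightarrow> nat \<Rightarrow> 'v \<Rightarrow> 'v set" where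
  "descendants V E \<rho> r v = {w \<in> V. tree_le V E \<rho> v w \<and> graph_dist V E v w = r}"

definition desc_gen_fun :: "'v set \<Rightarrow> 'v set set \<Rightarrow> 'v \<Rightarrow> real \<Rightarrow> 'v \<Rightarrow> real" where
  "desc_gen_fun V E \<rho> b v = (\<Sum>r. real (card (descendants V E \<rho> r v)) * b ^ r)"

definition desc_gen_norm :: "'v set \<Rightarrow> 'v set set \<Rightarrow> 'v \<Rightarrow> real \<Rightarrow> real" where
  "desc_gen_norm V E \<rho> b = sqrt (\<Sum>v\<in>V. (desc_gen_fun V E \<rho> b v)\<^sup>2)"


section \<open>Transportation metrics and relative entropy\<close>

definition couplings :: "'x measure \<Rightarrow> 'x measure \<Rightarrow> ('x \<times> 'x) measure set" where
  "couplings \<mu> \<nu> =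
     {\<gamma>. sets \<gamma> = sets (\<mu> \<Otimes>\<^sub>M \<nu>) \<and> distr \<gamma> \<mu> fst = \<mu> \<and> distr \<gamma> \<nu> snd = \<nu>}"

definition transport_dist :: "('x \<Rightarrow> 'x \<Rightarrow> real) \<Rightarrow> 'x measure \<Rightarrow> 'x measure \<Rightarrow> ennreal" where
  "transport_dist d \<mu> \<nu> = (INF \<gamma>\<in>couplings \<mu> \<nu>. \<integral>\<^sup>+ (x, y). ennreal (d x y) \<partial>\<gamma>)"

text \<open>
  Configurations over the vertex set \<open>V\<close> are the extensional functions \<open>V \<rightarrow>\<^sub>E UNIV\<close>.
  Since the spaces considered are second countable and \<open>V\<close> is finite, the product
  \<open>\<sigma>\<close>-algebra is the Borel \<open>\<sigma>\<close>-algebra of the product space.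
\<close>

abbreviation config_space :: "'v set \<Rightarrow> ('v \<Rightarrow> 'a::topological_space) measure" where
  "config_space V \<equiv> Pi\<^sub>M V (\<lambda>_. borel)"

definition hamming :: "'v set \<Rightarrow> ('v \<Rightarrow> 'a::metric_space) \<Rightarrow> ('v \<Rightarrow> 'a) \<Rightarrow> real" where
  "hamming V x y = 1 / real (card V) * (\<Sum>v\<in>V. dist (x v) (y v))"

text \<open>
  The extended integral of \<open>log (d\<mu>/d\<nu>)\<close> with respect to \<open>\<mu>\<close>, as the difference of the
  integrals of the positive and the negative part. For probability measures the latter is always
  finite, and the value is \<open>\<infinity>\<close> when the former is infinite (where the real-valued
  \<^const>\<open>KL_divergence\<close> would be \<open>0\<close>).
\<close>

definition rel_entropy :: "'x measure \<Rightarrow> 'x measure \<Rightarrow> ereal" where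
  "rel_entropy \<mu> \<nu> =
     (if absolutely_continuous \<nu> \<mu> then
        enn2ereal (\<integral>\<^sup>+ x. ennreal (entropy_density (exp 1) \<nu> \<mu> x) \<partial>\<mu>) -
        enn2ereal (\<integral>\<^sup>+ x. ennreal (- entropy_density (exp 1) \<nu> \<mu> x) \<partial>\<mu>)
      else \<infinity>)"

definition sqrt_ereal :: "ereal \<Rightarrow> ereal" where
  "sqrt_ereal x = (if x = \<infinity> then \<infinity> else ereal (sqrt (real_of_ereal x)))"


section \<open>Markov measures indexed by a tree\<close>

text \<open>
  \<open>layer_integral V E \<rho> \<nu>\<^sub>\<rho> q m k F y\<close> integrates \<open>F\<close> successively over the \<open>m\<close> layers
  \<open>k\<close>, \dots, \<open>k + m - 1\<close>, with layer \<open>k\<close> outermost, given the values of \<open>y\<close> on the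
  layers below \<open>k\<close>. The coordinates in one layer are independent given the previous layer.
\<close>

primrec layer_integral ::
  "'v set \<Rightarrow> 'v set set \<Rightarrow> 'v \<Rightarrow> 'a measure \<Rightarrow> ('v \<Rightarrow> 'a \<Rightarrow> 'a measure) \<Rightarrow>
   nat \<Rightarrow> nat \<Rightarrow> (('v \<Rightarrow> 'a) \<Rightarrow> ennreal) \<Rightarrow> ('v \<Rightarrow> 'a) \<Rightarrow> ennreal" where
  "layer_integral V E \<rho> \<nu>\<^sub>\<rho> q 0 k F y = F y"
| "layer_integral V E \<rho> \<nu>\<^sub>\<rho> q (Suc m) k F y =
     (\<integral>\<^sup>+ z. layer_integral V E \<rho> \<nu>\<^sub>\<rho> q m (Suc k) F (override_on y z (layer V E \<rho> k))
        \<partial>Pi\<^sub>M (layer V E \<rho> k) (\<lambda>v. if v = \<rho> then \<nu>\<^sub>\<rho> else q v (y (parent V E \<rho> v))))"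

text \<open>The initial configuration is irrelevant on \<open>V\<close>; \<open>undefined\<close> keeps the result extensional.\<close>

definition markov_measure ::
  "'v set \<Rightarrow> 'v set set \<Rightarrow> 'v \<Rightarrow> 'a::metric_space measure \<Rightarrow>
   ('v \<Rightarrow> 'a \<Rightarrow> 'a measure) \<Rightarrow> ('v \<Rightarrow> 'a) measure \<Rightarrow> bool" where
  "markov_measure V E \<rho> \<nu>\<^sub>\<rho> q \<nu> \<longleftrightarrow>
     \<nu>\<^sub>\<rho> \<in> space (prob_algebra borel) \<and>
     (\<forall>v\<in>V - {\<rho>}. q v \<in> borel \<rightarrow>\<^sub>M prob_algebra borel) \<and>
     \<nu> \<in> space (prob_algebra (config_space V)) \<and>
     (\<forall>A\<in>sets (config_space V).
        emeasure \<nu> A =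
        layer_integral V E \<rho> \<nu>\<^sub>\<rho> q (Suc (tree_depth V E \<rho>)) 0 (indicator A) (\<lambda>_. undefined))"

definition lipschitz_kernel :: "real \<Rightarrow> ('a::metric_space \<Rightarrow> 'a measure) \<Rightarrow> bool" where
  "lipschitz_kernel b q \<longleftrightarrow>
     (\<forall>x y. transport_dist dist (q x) (q y) \<le> ennreal (b * dist x y))"

end

theory Submission
  imports Defs
begin

text \<open>
  \<^emph>\<open>Exponential moments.\<close> List the vertices of the tree layer by layer and sample the Markov
  measure one vertex at a time. Replacing a function by its average over the last vertex \<open>v\<close> of
  the list lowers its exponential moment by a factor of at most \<open>exp (c(v)\<^sup>2 / 8)\<close>, by Hoeffding's lemma, where \<open>c(v)\<close> is
  the Lipschitz constant of the function in coordinate \<open>v\<close>; the diameter bound makes \<open>c(v)\<close> a bound for the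
  oscillation. The average no longer depends on coordinate \<open>v\<close> itself, but as the law of \<open>v\<close> moves by at most
  \<open>b * d\<close> when its parent moves by \<open>d\<close>, the Lipschitz constant at the parent grows by
  \<open>b * c(v)\<close> (\<open>mean_coord_lipschitz\<close>). If all constants are \<open>\<bar>t\<bar>\<close> at the start, then the constant at \<open>v\<close>
  has grown to at most \<open>\<bar>t\<bar> * \<delta>(v)\<close> when \<open>v\<close> is averaged out, because \<open>\<delta>(v)\<close> is \<open>1\<close> plus
  \<open>b\<close> times the sum of \<open>\<delta>\<close> over the children of \<open>v\<close> (\<open>desc_gen_fun_children\<close>).
  The product of the factors is \<open>exp (t\<^sup>2 * \<Delta>\<^sup>2 / 8)\<close>. The induction (\<open>exp_moment_run\<close>) is carried out for
  an arbitrary matrix of influences between the coordinates.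

  \<^emph>\<open>Transportation and entropy.\<close> The Gibbs variational inequality bounds the difference of the means
  of a Lipschitz function under \<open>\<mu>\<close> and \<open>\<nu>\<close> by the entropy and the
  exponential moment; the best choice of \<open>t\<close> gives \<open>\<Delta> / n * sqrt (D / 2)\<close>. By Kantorovich
  duality the supremum of these differences is the transportation distance. Only bounded costs on a space with a
  discretisation are needed, and there the duality has an elementary proof: on a finite set it is an instance of
  Farkas' lemma (\<open>finite_kantorovich_duality\<close>), and a coupling of discretised measures lifts to one of the
  original measures by product measures inside the cells (\<open>kantorovich_duality_simple\<close>).
  The discretisations of the configuration space come from simple functions that converge pointwise to the
  identity of the Polish space.
\<close>

section \<open>Paths and descendants in a finite rooted tree\<close>

text \<open>
  Two simple paths with the same ends that first differ after \<open>u\<close> close up to a cycle: follow the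
  first one until it meets the second one again, then return along the second one.
\<close>

lemma simple_path_unique:
  assumes acyclic: "\<nexists>p. is_cycle V E p"
  shows "simple_path V E u p w \<Longrightarrow> simple_path V E u q w \<Longrightarrow> p = q"
proof (induction p arbitrary: u q)
  case Nil
  then show ?case by (simp add: simple_path_def walk_def)
next
  case (Cons a p)
  from Cons.prems obtain q' where q: "q = u # q'" and a: "a = u"
    by (cases q) (auto simp: simple_path_def walk_def)
  show ?case
  proof (cases "p = [] \<or> q' = []")
    case True
    have "w = u" using Cons.prems True by (auto simp: simple_path_def walk_def a q)
    moreover have "r = []" if "simple_path V E u (u # r) u" for r
      using that last_in_set[of r] by (auto simp: simple_path_def walk_def split: if_splits)
      ultimately have "p = []" "q' = []" using Cons.prems unfolding a q by blast+
    then show ?thesis by (simp add: a q)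
  next
    case False
    have p_path: "simple_path V E (hd p) p w" and q_path: "simple_path V E (hd q') q' w"
      and edges: "{u, hd p} \<in> E" "{u, hd q'} \<in> E" and fresh: "u \<notin> set p" "u \<notin> set q'" "u \<in> V"
      using Cons.prems False by (auto simp: simple_path_def walk_def a q successively_Cons)
    have "hd p = hd q'"
    proof (rule ccontr)
      assume neq: "hd p \<noteq> hd q'"
      have "p \<noteq> []" "last p = w" "q' \<noteq> []" "last q' = w"
        using p_path q_path unfolding simple_path_def walk_def by blast+
      then have "w \<in> set p" "w \<in> set q'" using last_in_set by metis+
      then have "\<exists>x\<in>set p. x \<in> set q'" by blast
      then obtain xs z ys where p: "p = xs @ z # ys" and z: "z \<in> set q'"
        and xs: "\<forall>x\<in>set xs. x \<notin> set q'"
        using split_list_first_prop[of p "\<lambda>x. x \<in> set q'"] by blast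
      from z obtain as bs where q': "q' = as @ z # bs" by (meson split_list)
      have "is_cycle V E (u # xs @ z # rev as)"
        unfolding is_cycle_def
      proof (intro conjI)
        show "3 \<le> length (u # xs @ z # rev as)"
          using neq by (cases xs; cases as) (auto simp: p q')
        show "set (u # xs @ z # rev as) \<subseteq> V"
          using p_path q_path fresh by (auto simp: simple_path_def walk_def p q')
        show "distinct (u # xs @ z # rev as)"
          using p_path q_path fresh xs by (auto simp: simple_path_def p q')
        have "successively (\<lambda>x y. {x, y} \<in> E) (xs @ [z])"
          using p_path by (auto simp: simple_path_def walk_def p successively_append_iff)
        moreover have "successively (\<lambda>x y. {x, y} \<in> E) (z # rev as)"
        proof -
          have "successively (\<lambda>x y. {x, y} \<in> E) (as @ [z])"
            using q_path by (auto simp: simple_path_def walk_def q' successively_append_iff)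
          then have "successively (\<lambda>x y. {x, y} \<in> E) (rev (as @ [z]))"
            by (simp only: successively_rev) (simp add: insert_commute)
          then show ?thesis by simp
        qed
        ultimately show "successively (\<lambda>x y. {x, y} \<in> E) (u # xs @ z # rev as)"
          using edges by (cases xs) (auto simp: p successively_Cons successively_append_iff hd_append)
        show "{last (u # xs @ z # rev as), hd (u # xs @ z # rev as)} \<in> E"
          using edges by (cases as) (auto simp: q' insert_commute)
      qed
      then show False using acyclic by blast
    qed
    then show ?thesis using Cons.IH[of "hd p" q'] p_path q_path by (simp add: a q)
  qed
qed

lemma simple_path_split:
  assumes "simple_path V E u (xs @ v # ys) w"
  shows "simple_path V E u (xs @ [v]) v" and "simple_path V E v (v # ys) w"
  using assms
  by (auto simp: simple_path_def walk_def successively_append_iff hd_append split: if_splits)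

locale rooted_tree =
  fixes V :: "'v set" and E :: "'v set set" and \<rho> :: 'v
  assumes tree: "finite_rooted_tree V E \<rho>"
begin

lemma finite_V [simp]: "finite V" and root_in_V [simp]: "\<rho> \<in> V"
  using tree by (auto simp: finite_rooted_tree_def)

lemma card_V_pos: "0 < card V"
  using finite_V root_in_V by (metis card_gt_0_iff empty_iff)

lemma path_unique: "simple_path V E u p w \<Longrightarrow> simple_path V E u q w \<Longrightarrow> p = q"
  using simple_path_unique tree by (metis finite_rooted_tree_def)

text \<open>
  A shortest walk is simple, since a repeated vertex would allow a shortcut. Distances in the tree
  are therefore lengths of its unique simple paths.
\<close>

lemma shortest_walk:
  assumes "u \<in> V" "w \<in> V"
  obtains p where "simple_path V E u p w" and "length p = Suc (graph_dist V E u w)"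
proof -
  let ?P = "\<lambda>k. \<exists>p. walk V E u p w \<and> length p = Suc k"
  obtain q where q: "walk V E u q w"
    using tree assms unfolding finite_rooted_tree_def by blast
  then have "?P (length q - 1)" by (intro exI[of _ q]) (auto simp: walk_def)
  then have "?P (graph_dist V E u w)" unfolding graph_dist_def by (rule LeastI)
  then obtain p where p: "walk V E u p w" "length p = Suc (graph_dist V E u w)" by blast
  have "distinct p"
  proof (rule ccontr)
    assume "\<not> distinct p"
    then obtain xs ys zs y where p_eq: "p = xs @ [y] @ ys @ [y] @ zs"
      using not_distinct_decomp by blast
    have "walk V E u (xs @ y # zs) w"
      using p(1) by (cases xs)
        (auto simp: walk_def p_eq successively_append_iff successively_Cons hd_append split: if_splits)
    then have "?P (length xs + length zs)" by auto
    then have "graph_dist V E u w \<le> length xs + length zs"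
      unfolding graph_dist_def by (rule Least_le)
    then show False using p(2) by (simp add: p_eq)
  qed
  then show thesis using p that by (simp add: simple_path_def)
qed

lemma length_simple_path:
  assumes "simple_path V E u p w"
  shows "length p = Suc (graph_dist V E u w)"
proof -
  have "u \<in> V" "w \<in> V"
    using assms by (auto simp: simple_path_def walk_def intro: hd_in_set last_in_set)
  then show ?thesis by (metis assms path_unique shortest_walk)
qed

text \<open>
  A neighbour of \<open>v\<close> that lies on the path from the root to \<open>v\<close> but is not its second
  to last vertex would close a cycle with the rest of the path.
\<close>

lemma parent_eqI:
  assumes p: "simple_path V E \<rho> (xs @ [u, v]) v"
  shows "parent V E \<rho> v = u"
  unfolding parent_def
proof (rule the_equality)
  have "{u, v} \<in> E"
    using p by (auto simp: simple_path_def walk_def successively_append_iff)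
  then show "{u, v} \<in> E \<and> tree_le V E \<rho> u v"
    using p by (fastforce simp: tree_le_def)
next
  fix u' assume u': "{u', v} \<in> E \<and> tree_le V E \<rho> u' v"
  then have "u' \<in> set (xs @ [u, v])"
    using p path_unique unfolding tree_le_def by metis
  moreover have "u' \<noteq> v"
    using u' tree by (auto simp: finite_rooted_tree_def)
  ultimately consider "u' = u" | "u' \<in> set xs" by auto
  then show "u' = u"
  proof cases
    case 2
    then obtain as bs where xs: "xs = as @ u' # bs" by (meson split_list)
    have "is_cycle V E (u' # bs @ [u, v])"
      using p u' by (auto simp: is_cycle_def simple_path_def walk_def xs successively_append_iff
        insert_commute)
    then show ?thesis using tree by (auto simp: finite_rooted_tree_def)
  qed
qed

lemma path_via_parent:
  assumes "v \<in> V - {\<rho>}"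
  obtains xs where "simple_path V E \<rho> (xs @ [parent V E \<rho> v, v]) v"
proof -
  obtain p where p: "simple_path V E \<rho> p v"
    using shortest_walk[of \<rho> v] assms by auto
  then obtain q where q: "p = q @ [v]"
    by (metis append_butlast_last_id simple_path_def walk_def)
  have "q \<noteq> []" using p assms by (auto simp: q simple_path_def walk_def)
  then obtain xs u where "p = xs @ [u, v]"
    by (metis append_butlast_last_id append_assoc append_Cons append_Nil q)
  then show thesis using that p parent_eqI by metis
qed

lemma parent_in_V: "v \<in> V - {\<rho>} \<Longrightarrow> parent V E \<rho> v \<in> V"
  by (erule path_via_parent) (auto simp: simple_path_def walk_def)

lemma root_dist_parent:
  assumes "v \<in> V - {\<rho>}"
  shows "graph_dist V E \<rho> v = Suc (graph_dist V E \<rho> (parent V E \<rho> v))"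
proof -
  obtain xs where xs: "simple_path V E \<rho> (xs @ [parent V E \<rho> v, v]) v"
    using assms by (rule path_via_parent)
  then have "simple_path V E \<rho> (xs @ [parent V E \<rho> v]) (parent V E \<rho> v)"
    by (rule simple_path_split(1))
  from length_simple_path[OF this] length_simple_path[OF xs] show ?thesis by simp
qed

text \<open>
  Descendants are read off from the unique paths that start at the root; this turns the recursion for
  the descendant generating function into list manipulation.
\<close>

lemma descendants_path:
  "x \<in> descendants V E \<rho> r v \<longleftrightarrow>
     (\<exists>xs ys. simple_path V E \<rho> (xs @ v # ys) x \<and> length ys = r)"
proof
  assume "x \<in> descendants V E \<rho> r v"
  then obtain p where p: "simple_path V E \<rho> p x" "v \<in> set p" and r: "graph_dist V E v x = r"
    by (auto simp: descendants_def tree_le_def)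
  then obtain xs ys where p_eq: "p = xs @ v # ys" by (meson split_list)
  have "length ys = r"
    using length_simple_path[OF simple_path_split(2)] p(1) r by (simp add: p_eq)
  then show "\<exists>xs ys. simple_path V E \<rho> (xs @ v # ys) x \<and> length ys = r"
    using p(1) p_eq by blast
next
  assume "\<exists>xs ys. simple_path V E \<rho> (xs @ v # ys) x \<and> length ys = r"
  then obtain xs ys where p: "simple_path V E \<rho> (xs @ v # ys) x" "length ys = r" by blast
  then have "graph_dist V E v x = r"
    using length_simple_path[OF simple_path_split(2)[OF p(1)]] by simp
  moreover have "x \<in> V"
    using p(1) unfolding simple_path_def walk_def by (metis last_in_set subsetD)
  ultimately show "x \<in> descendants V E \<rho> r v"
    using p(1) by (fastforce simp: descendants_def tree_le_def)
qed

lemma finite_descendants [simp]: "finite (descendants V E \<rho> r v)"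
  by (simp add: descendants_def)

lemma descendants_subset_parent:
  assumes "w \<in> V - {\<rho>}"
  shows "descendants V E \<rho> r w \<subseteq> descendants V E \<rho> (Suc r) (parent V E \<rho> w)"
proof
  fix x assume "x \<in> descendants V E \<rho> r w"
  then obtain xs ys where p: "simple_path V E \<rho> (xs @ w # ys) x" "length ys = r"
    by (auto simp: descendants_path)
  obtain xs' where "simple_path V E \<rho> (xs' @ [parent V E \<rho> w, w]) w"
    using assms by (rule path_via_parent)
  then have "xs @ [w] = xs' @ [parent V E \<rho> w, w]"
    using path_unique[OF simple_path_split(1)[OF p(1)]] by blast
  then have "xs @ w # ys = xs' @ parent V E \<rho> w # w # ys" by auto
  then show "x \<in> descendants V E \<rho> (Suc r) (parent V E \<rho> w)"
    using p unfolding descendants_path by (metis length_Cons)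
qed

lemma descendants_disjoint:
  assumes "w \<noteq> w'"
  shows "descendants V E \<rho> r w \<inter> descendants V E \<rho> r w' = {}"
proof -
  have False if "x \<in> descendants V E \<rho> r w" "x \<in> descendants V E \<rho> r w'" for x
  proof -
    from that obtain xs ys xs' ys' where
      "simple_path V E \<rho> (xs @ w # ys) x" "length ys = r"
      "simple_path V E \<rho> (xs' @ w' # ys') x" "length ys' = r"
      by (auto simp: descendants_path)
    then show False using assms path_unique by fastforce
  qed
  then show ?thesis by blast
qed

lemma self_in_descendants:
  assumes "v \<in> V" shows "v \<in> descendants V E \<rho> 0 v"
proof -
  obtain p where p: "simple_path V E \<rho> p v" using shortest_walk[OF root_in_V assms] by blast
  then have "p = butlast p @ [v]" by (metis append_butlast_last_id simple_path_def walk_def)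
  then show ?thesis using p by (metis descendants_path list.size(3))
qed

lemma descendants_empty:
  assumes "card V \<le> r" shows "descendants V E \<rho> r v = {}"
proof -
  have False if "simple_path V E \<rho> (xs @ v # ys) x" "length ys = r" for xs ys x
  proof -
    have "length (xs @ v # ys) = card (set (xs @ v # ys))"
      using that(1) unfolding simple_path_def by (metis distinct_card)
    also have "\<dots> \<le> card V"
      using that(1) unfolding simple_path_def walk_def by (intro card_mono) auto
    finally show False using that(2) assms by simp
  qed
  then show ?thesis unfolding set_eq_iff descendants_path by blast
qed

lemma desc_gen_fun_eq_sum:
  assumes "card V \<le> N"
  shows "desc_gen_fun V E \<rho> b v = (\<Sum>r<N. real (card (descendants V E \<rho> r v)) * b ^ r)"
  unfolding desc_gen_fun_def
  by (rule suminf_finite) (use assms in \<open>auto simp: descendants_empty\<close>)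

definition children :: "'v \<Rightarrow> 'v set" where
  "children v = {w \<in> V - {\<rho>}. parent V E \<rho> w = v}"

text \<open>
  The sets \<open>D\<^sub>r(w)\<close> over the children \<open>w\<close> of \<open>v\<close> are disjoint and
  contained in the set \<open>D\<^sub>r\<^sub>+\<^sub>1(v)\<close>. Equality holds as well, but this direction is the one
  that the propagation of Lipschitz constants along the tree asks for: \<open>\<delta>\<close> is a
  supersolution of \<open>C(v) = 1 + b * (\<Sum>w. C(w))\<close>, the sum being over the children of \<open>v\<close>.
\<close>

lemma desc_gen_fun_children:
  assumes v: "v \<in> V" and b: "0 \<le> b"
  shows "1 + b * (\<Sum>w\<in>children v. desc_gen_fun V E \<rho> b w) \<le> desc_gen_fun V E \<rho> b v"
proof -
  let ?D = "descendants V E \<rho>"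
  have fin: "finite (children v)" by (simp add: children_def)
  have le: "(\<Sum>w\<in>children v. card (?D r w)) \<le> card (?D (Suc r) v)" for r
  proof -
    have "(\<Sum>w\<in>children v. card (?D r w)) = card (\<Union>w\<in>children v. ?D r w)"
      using fin by (subst card_UN_disjoint) (auto dest: descendants_disjoint)
    also have "\<dots> \<le> card (?D (Suc r) v)"
      using descendants_subset_parent by (intro card_mono) (auto simp: children_def)
    finally show ?thesis .
  qed
  have "1 \<le> card (?D 0 v)"
    using self_in_descendants[OF v] by (metis One_nat_def Suc_leI card_gt_0_iff empty_iff finite_descendants)
  moreover have "b * (\<Sum>w\<in>children v. desc_gen_fun V E \<rho> b w)
      \<le> (\<Sum>r<card V. real (card (?D (Suc r) v)) * b ^ Suc r)"
  proof -
    have "b * (\<Sum>w\<in>children v. desc_gen_fun V E \<rho> b w)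
        = (\<Sum>r<card V. b ^ Suc r * real (\<Sum>w\<in>children v. card (?D r w)))"
      by (simp add: desc_gen_fun_eq_sum[OF order_refl] sum_distrib_left mult_ac
        sum.swap[of _ "children v"])
    also have "\<dots> \<le> (\<Sum>r<card V. b ^ Suc r * real (card (?D (Suc r) v)))"
      using le b by (intro sum_mono mult_left_mono) (auto simp del: of_nat_sum)
    finally show ?thesis by (simp add: mult_ac)
  qed
  ultimately show ?thesis
    by (simp add: desc_gen_fun_eq_sum[of "Suc (card V)" b v] sum.lessThan_Suc_shift
        del: sum.lessThan_Suc power_Suc)
qed

lemma desc_gen_fun_ge_1:
  assumes "v \<in> V" "0 \<le> b" shows "1 \<le> desc_gen_fun V E \<rho> b v"
proof -
  have "0 \<le> desc_gen_fun V E \<rho> b w" for w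
    using assms(2) by (simp add: desc_gen_fun_eq_sum[OF order_refl] sum_nonneg)
  then have "0 \<le> b * (\<Sum>w\<in>children v. desc_gen_fun V E \<rho> b w)"
    using assms(2) by (intro mult_nonneg_nonneg sum_nonneg) auto
  with desc_gen_fun_children[OF assms] show ?thesis by simp
qed

end


section \<open>Kantorovich duality on finite sets\<close>

definition linear_functional :: "(('k \<Rightarrow> real) \<Rightarrow> real) \<Rightarrow> bool" where
  "linear_functional \<phi> \<longleftrightarrow> (\<forall>x y c. \<phi> (\<lambda>k. x k + c * y k) = \<phi> x + c * \<phi> y)"

text \<open>
  The proof is Bartl's induction on the number of functionals. If the last functional \<open>\<psi> j\<close>
  is needed, there is a vector \<open>z\<close> on which it is negative while all others are nonnegative;
  projecting along \<open>z\<close> onto the kernel of \<open>\<psi> j\<close> removes \<open>\<psi> j\<close>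
  from the hypothesis. No topology enters, so that the space \<open>'k \<Rightarrow> real\<close> may
  have any dimension.
\<close>

lemma farkas:
  assumes "finite I"
  shows "linear_functional \<phi> \<Longrightarrow> (\<And>i. i \<in> I \<Longrightarrow> linear_functional (\<psi> i)) \<Longrightarrow>
    (\<And>x. (\<And>i. i \<in> I \<Longrightarrow> 0 \<le> \<psi> i x) \<Longrightarrow> 0 \<le> \<phi> x) \<Longrightarrow>
    \<exists>c. (\<forall>i\<in>I. 0 \<le> c i) \<and> (\<forall>x. \<phi> x = (\<Sum>i\<in>I. c i * \<psi> i x))"
  using assms
proof (induction I arbitrary: \<phi> \<psi> rule: finite_induct)
  case empty
  have "\<phi> x = 0" for x
  proof -
    have "\<phi> (\<lambda>k. x k + (-2) * x k) = - \<phi> x"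
      using empty.prems(1)[unfolded linear_functional_def, rule_format, of x "-2" x] by simp
    then show ?thesis using empty.prems(3)[of x] empty.prems(3)[of "\<lambda>k. x k + (-2) * x k"] by simp
  qed
  then show ?case by simp
next
  case (insert j I)
  show ?case
  proof (cases "\<forall>x. (\<forall>i\<in>I. 0 \<le> \<psi> i x) \<longrightarrow> 0 \<le> \<phi> x")
    case True
    then obtain c where "\<forall>i\<in>I. 0 \<le> c i" "\<forall>x. \<phi> x = (\<Sum>i\<in>I. c i * \<psi> i x)"
      using insert.IH[of \<phi> \<psi>] insert.prems by auto
    then show ?thesis
      using insert.hyps by (intro exI[of _ "c(j := 0)"]) (auto intro!: sum.cong)
  next
    case False
    then obtain z where z: "\<forall>i\<in>I. 0 \<le> \<psi> i z" "\<phi> z < 0" by force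
    then have neg: "\<psi> j z < 0"
      using insert.prems(3)[of z] by (metis insert_iff not_le)
    \<comment> \<open>\<open>shift x\<close> is the projection of \<open>x\<close> along \<open>z\<close> onto the kernel of \<open>\<psi> j\<close>.\<close>
    define shift where "shift x = (\<lambda>k. x k + (\<psi> j x / - \<psi> j z) * z k)" for x
    have lin: "\<xi> (shift x) = \<xi> x + (\<psi> j x / - \<psi> j z) * \<xi> z" if "linear_functional \<xi>" for \<xi> x
      using that unfolding linear_functional_def shift_def by blast
    have lin': "linear_functional (\<lambda>x. \<xi> (shift x))" if "linear_functional \<xi>" for \<xi>
    proof -
      have "linear_functional (\<psi> j)" using insert.prems(2) by simp
      then show ?thesis using that unfolding linear_functional_def lin[OF that]
        by (simp add: algebra_simps add_divide_distrib diff_divide_distrib)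
    qed
    have ker: "\<psi> j (shift x) = 0" for x
      using lin[of "\<psi> j" x] insert.prems(2)[of j] neg by simp
    have "0 \<le> \<phi> (shift x)" if "\<And>i. i \<in> I \<Longrightarrow> 0 \<le> \<psi> i (shift x)" for x
      by (rule insert.prems(3)) (use that ker in auto)
    then obtain c where c: "\<forall>i\<in>I. 0 \<le> c i" "\<forall>x. \<phi> (shift x) = (\<Sum>i\<in>I. c i * \<psi> i (shift x))"
      using insert.IH[of "\<lambda>x. \<phi> (shift x)" "\<lambda>i x. \<psi> i (shift x)"] lin' insert.prems by auto
    define s where "s = (\<Sum>i\<in>I. c i * \<psi> i z)"
    define a where "a = (s - \<phi> z) / - \<psi> j z"
    have "0 \<le> s" using c(1) z(1) by (auto simp: s_def intro!: sum_nonneg)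
    then have "0 \<le> a" using z(2) neg by (simp add: a_def divide_nonneg_neg)
    moreover have "\<phi> x = (\<Sum>i\<in>I. c i * \<psi> i x) + a * \<psi> j x" for x
    proof -
      have "\<phi> x + (\<psi> j x / - \<psi> j z) * \<phi> z
          = (\<Sum>i\<in>I. c i * (\<psi> i x + (\<psi> j x / - \<psi> j z) * \<psi> i z))"
        using c(2) lin insert.prems by simp
      also have "\<dots> = (\<Sum>i\<in>I. c i * \<psi> i x) + (\<psi> j x / - \<psi> j z) * s"
        unfolding s_def sum_distrib_left sum.distrib[symmetric] by (intro sum.cong) (auto simp: algebra_simps)
      finally show ?thesis using neg by (simp add: a_def field_simps)
    qed
    ultimately show ?thesis
      using c(1) insert.hyps
      by (intro exI[of _ "c(j := a)"]) (auto simp: add.commute intro!: sum.cong)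
  qed
qed

text \<open>
  Farkas' lemma applied to triples of two potentials \<open>F\<close>, \<open>G\<close> and a scaling \<open>T\<close> of the cost.
  The dual constraints are \<open>F i + G j \<le> T * c i j\<close> and \<open>0 \<le> T\<close>; their multipliers are the entries of the coupling and
  the slack in the cost. Because \<open>c\<close> is a pseudometric, a feasible pair of potentials can be
  improved to \<open>h\<close>, \<open>- h\<close> with a single \<open>T\<close>-Lipschitz function \<open>h\<close>, to which the hypothesis on
  Lipschitz functions applies.
\<close>

lemma finite_kantorovich_duality:
  fixes c :: "'w \<Rightarrow> 'w \<Rightarrow> real" and p p' :: "'w \<Rightarrow> real"
  assumes fin: "finite W" "W \<noteq> {}"
    and c_refl: "\<And>i. i \<in> W \<Longrightarrow> c i i = 0"
    and sym: "\<And>i j. i \<in> W \<Longrightarrow> j \<in> W \<Longrightarrow> c i j = c j i"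
    and tri: "\<And>i j k. i \<in> W \<Longrightarrow> j \<in> W \<Longrightarrow> k \<in> W \<Longrightarrow> c i k \<le> c i j + c j k"
    and p: "\<And>i. i \<in> W \<Longrightarrow> 0 \<le> p i" "\<And>i. i \<in> W \<Longrightarrow> 0 \<le> p' i" "sum p W = sum p' W"
    and bound: "\<And>f. (\<And>i j. i \<in> W \<Longrightarrow> j \<in> W \<Longrightarrow> \<bar>f i - f j\<bar> \<le> c i j) \<Longrightarrow>
      (\<Sum>i\<in>W. f i * p i) - (\<Sum>i\<in>W. f i * p' i) \<le> S"
  obtains m where "\<And>i j. i \<in> W \<Longrightarrow> j \<in> W \<Longrightarrow> 0 \<le> m i j"
    and "\<And>i. i \<in> W \<Longrightarrow> (\<Sum>j\<in>W. m i j) = p i"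
    and "\<And>j. j \<in> W \<Longrightarrow> (\<Sum>i\<in>W. m i j) = p' j"
    and "(\<Sum>i\<in>W. \<Sum>j\<in>W. m i j * c i j) \<le> S"
proof -
  \<comment> \<open>A vector \<open>x\<close> encodes a pair of potentials and a scaling of the cost.\<close>
  define F G T where FGT: "F x i = x (Some (Inl i))" "G x i = x (Some (Inr i))" "T x = x None"
    for x :: "('w + 'w) option \<Rightarrow> real" and i
  define \<phi> where "\<phi> x = S * T x - (\<Sum>i\<in>W. F x i * p i) - (\<Sum>i\<in>W. G x i * p' i)" for x
  define \<psi> where "\<psi> k x = (case k of None \<Rightarrow> T x | Some (i, j) \<Rightarrow> T x * c i j - F x i - G x j)"
    for k x
  define I where "I = insert None (Some ` (W \<times> W))"
  have "\<exists>m. (\<forall>k\<in>I. 0 \<le> m k) \<and> (\<forall>x. \<phi> x = (\<Sum>k\<in>I. m k * \<psi> k x))"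
  proof (rule farkas)
    show "finite I" using fin by (simp add: I_def)
    show "linear_functional \<phi>"
      unfolding linear_functional_def \<phi>_def FGT
      by (auto simp: algebra_simps sum.distrib sum_distrib_left)
    show "linear_functional (\<psi> k)" for k
      unfolding linear_functional_def \<psi>_def FGT by (auto simp: algebra_simps split: option.split)
    fix x assume pos: "\<And>k. k \<in> I \<Longrightarrow> 0 \<le> \<psi> k x"
    have T: "0 \<le> T x" using pos[of None] by (simp add: I_def \<psi>_def)
    have FG: "F x i + G x j \<le> T x * c i j" if "i \<in> W" "j \<in> W" for i j
      using pos[of "Some (i, j)"] that by (simp add: I_def \<psi>_def image_iff)
    \<comment> \<open>The best potential that is compatible with \<open>G x\<close>; it dominates \<open>F x\<close>.\<close>
    define h where "h i = (MIN j\<in>W. T x * c i j - G x j)" for i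
    have h_le: "h i \<le> T x * c i j - G x j" if "j \<in> W" for i j
      unfolding h_def using fin that by (intro Min_le) auto
    have h_ex: "\<exists>j\<in>W. h i = T x * c i j - G x j" for i
    proof -
      have "h i \<in> (\<lambda>j. T x * c i j - G x j) ` W"
        unfolding h_def using fin by (intro Min_in) auto
      then show ?thesis by blast
    qed
    have h_diff: "h i - h j \<le> T x * c i j" if ij: "i \<in> W" "j \<in> W" for i j
    proof -
      obtain k where k: "k \<in> W" "h j = T x * c j k - G x k" using h_ex by blast
      have "T x * c i k \<le> T x * (c i j + c j k)"
        using tri[of i j k] ij k(1) T by (intro mult_left_mono) auto
      then show ?thesis using h_le[OF k(1), of i] k(2) by (simp add: algebra_simps)
    qed
    have "(\<Sum>i\<in>W. F x i * p i) \<le> (\<Sum>i\<in>W. h i * p i)"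
    proof (intro sum_mono mult_right_mono p)
      fix i assume i: "i \<in> W"
      obtain j where "j \<in> W" "h i = T x * c i j - G x j" using h_ex by blast
      then show "F x i \<le> h i" using FG[OF i, of j] by simp
    qed
    moreover have "(\<Sum>i\<in>W. G x i * p' i) \<le> (\<Sum>i\<in>W. - h i * p' i)"
    proof (intro sum_mono mult_right_mono p)
      fix i assume i: "i \<in> W"
      then show "G x i \<le> - h i" using h_le[OF i, of i] c_refl by simp
    qed
    moreover have "(\<Sum>i\<in>W. h i * p i) - (\<Sum>i\<in>W. h i * p' i) \<le> S * T x"
    proof (cases "T x = 0")
      case True
      obtain i0 where "i0 \<in> W" using fin by blast
      then have "h i = h i0" if "i \<in> W" for i
        using h_diff[of i i0] h_diff[of i0 i] that True by simp
      then show ?thesis using p(3) True by (simp flip: sum_distrib_left)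
    next
      case False
      then have pos: "0 < T x" using T by simp
      have "\<bar>h i / T x - h j / T x\<bar> \<le> c i j" if "i \<in> W" "j \<in> W" for i j
        using h_diff[OF that] h_diff[OF that(2,1)] sym[OF that] pos
        by (simp add: field_simps abs_le_iff)
      then have "(\<Sum>i\<in>W. h i / T x * p i) - (\<Sum>i\<in>W. h i / T x * p' i) \<le> S"
        by (rule bound)
      then have "T x * ((\<Sum>i\<in>W. h i / T x * p i) - (\<Sum>i\<in>W. h i / T x * p' i)) \<le> T x * S"
        using pos by simp
      then show ?thesis using pos by (simp add: right_diff_distrib sum_distrib_left mult_ac)
    qed
    ultimately show "0 \<le> \<phi> x" by (simp add: \<phi>_def sum_negf)
  qed
  then obtain m where m: "\<And>k. k \<in> I \<Longrightarrow> 0 \<le> m k" "\<And>x. \<phi> x = (\<Sum>k\<in>I. m k * \<psi> k x)" by blast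
  have expand: "\<phi> x = m None * T x
      + (\<Sum>i\<in>W. \<Sum>j\<in>W. m (Some (i, j)) * (T x * c i j - F x i - G x j))" for x
  proof -
    have "\<phi> x = m None * \<psi> None x + (\<Sum>k\<in>Some ` (W \<times> W). m k * \<psi> k x)"
      using fin by (simp add: m(2) I_def)
    also have "(\<Sum>k\<in>Some ` (W \<times> W). m k * \<psi> k x)
        = (\<Sum>i\<in>W. \<Sum>j\<in>W. m (Some (i, j)) * (T x * c i j - F x i - G x j))"
      by (simp add: sum.reindex sum.cartesian_product \<psi>_def case_prod_unfold)
    finally show ?thesis by (simp add: \<psi>_def)
  qed
  show thesis
  proof (rule that[of "\<lambda>i j. m (Some (i, j))"])
    show "0 \<le> m (Some (i, j))" if "i \<in> W" "j \<in> W" for i j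
      using that by (intro m(1)) (auto simp: I_def)
    \<comment> \<open>Comparing the coefficients of the two sides of the identity.\<close>
    show "(\<Sum>j\<in>W. m (Some (i, j))) = p i" if i: "i \<in> W" for i
    proof -
      define x :: "('w + 'w) option \<Rightarrow> real" where "x k = (if k = Some (Inl i) then - 1 else 0)" for k
      have FGx: "T x = 0" "G x = (\<lambda>_. 0)" "F x = (\<lambda>k. if k = i then - 1 else 0)"
        by (auto simp: FGT x_def)
      then have "\<phi> x = (\<Sum>k\<in>W. if k = i then p k else 0)"
        by (auto simp: \<phi>_def sum_negf[symmetric] intro!: sum.cong)
      moreover have "\<phi> x = (\<Sum>k\<in>W. if k = i then (\<Sum>j\<in>W. m (Some (k, j))) else 0)"
        unfolding expand using FGx by (auto intro!: sum.cong)
      ultimately show ?thesis using fin i by simp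
    qed
    show "(\<Sum>i\<in>W. m (Some (i, j))) = p' j" if j: "j \<in> W" for j
    proof -
      define x :: "('w + 'w) option \<Rightarrow> real" where "x k = (if k = Some (Inr j) then - 1 else 0)" for k
      have FGx: "T x = 0" "F x = (\<lambda>_. 0)" "G x = (\<lambda>k. if k = j then - 1 else 0)"
        by (auto simp: FGT x_def)
      then have "\<phi> x = (\<Sum>k\<in>W. if k = j then p' k else 0)"
        by (auto simp: \<phi>_def sum_negf[symmetric] intro!: sum.cong)
      moreover have "\<phi> x = (\<Sum>i\<in>W. \<Sum>k\<in>W. if k = j then m (Some (i, k)) else 0)"
        unfolding expand using FGx by (auto intro!: sum.cong)
      ultimately show ?thesis using fin j by simp
    qed
    show "(\<Sum>i\<in>W. \<Sum>j\<in>W. m (Some (i, j)) * c i j) \<le> S"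
    proof -
      define x :: "('w + 'w) option \<Rightarrow> real" where "x k = (if k = None then 1 else 0)" for k
      have FGx: "T x = 1" "F x = (\<lambda>_. 0)" "G x = (\<lambda>_. 0)"
        by (auto simp: FGT x_def)
      then have "\<phi> x = S" by (simp add: \<phi>_def)
      moreover have "\<phi> x = m None + (\<Sum>i\<in>W. \<Sum>j\<in>W. m (Some (i, j)) * c i j)"
        unfolding expand FGx by simp
      ultimately show ?thesis using m(1)[of None] by (simp add: I_def)
    qed
  qed
qed


section \<open>Kantorovich duality for measures\<close>

lemma (in prob_space) simple_function_law:
  fixes \<Phi> :: "'a \<Rightarrow> 'b" and f :: "'b \<Rightarrow> ennreal" and g :: "'b \<Rightarrow> real"
  assumes \<Phi>: "simple_function M \<Phi>"
  defines "W \<equiv> \<Phi> ` space M" and "p \<equiv> \<lambda>w. measure M (\<Phi> -` {w} \<inter> space M)"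
  shows nn_integral_simple_function_law: "(\<integral>\<^sup>+x. f (\<Phi> x) \<partial>M) = (\<Sum>w\<in>W. f w * ennreal (p w))"
    and integral_simple_function_law: "(\<integral>x. g (\<Phi> x) \<partial>M) = (\<Sum>w\<in>W. g w * p w)"
    and AE_simple_function_law: "AE x in M. p (\<Phi> x) \<noteq> 0"
proof -
  have W: "finite W" using \<Phi> by (simp add: W_def simple_function_def)
  have \<Phi>_W: "\<Phi> x \<in> W" if "x \<in> space M" for x using that by (simp add: W_def)
  have [measurable]: "\<Phi> -` {w} \<inter> space M \<in> sets M" for w
    using \<Phi> by (rule simple_functionD)
  have nn: "(\<integral>\<^sup>+x. f (\<Phi> x) \<partial>M) = (\<Sum>w\<in>W. f w * ennreal (p w))" for f :: "'b \<Rightarrow> ennreal"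
  proof -
    have "(\<integral>\<^sup>+x. f (\<Phi> x) \<partial>M) = (\<integral>\<^sup>+x. (\<Sum>w\<in>W. f w * indicator (\<Phi> -` {w} \<inter> space M) x) \<partial>M)"
      using W \<Phi>_W by (intro nn_integral_cong) (auto simp: indicator_def if_distrib cong: if_cong)
    also have "\<dots> = (\<Sum>w\<in>W. \<integral>\<^sup>+x. f w * indicator (\<Phi> -` {w} \<inter> space M) x \<partial>M)"
      by (intro nn_integral_sum) measurable
    also have "\<dots> = (\<Sum>w\<in>W. f w * ennreal (p w))"
      by (simp add: nn_integral_cmult_indicator p_def emeasure_eq_measure)
    finally show ?thesis .
  qed
  then show "(\<integral>\<^sup>+x. f (\<Phi> x) \<partial>M) = (\<Sum>w\<in>W. f w * ennreal (p w))" .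
  have "(\<integral>x. g (\<Phi> x) \<partial>M) = (\<integral>x. (\<Sum>w\<in>W. g w * indicator (\<Phi> -` {w} \<inter> space M) x) \<partial>M)"
    using W \<Phi>_W by (intro Bochner_Integration.integral_cong)
      (auto simp: indicator_def if_distrib cong: if_cong)
  also have "\<dots> = (\<Sum>w\<in>W. \<integral>x. g w * indicator (\<Phi> -` {w} \<inter> space M) x \<partial>M)"
    by (intro Bochner_Integration.integral_sum integrable_mult_right integrable_real_indicator)
      (auto simp: less_top[symmetric])
  also have "\<dots> = (\<Sum>w\<in>W. g w * p w)"
    by (simp add: p_def)
  finally show "(\<integral>x. g (\<Phi> x) \<partial>M) = (\<Sum>w\<in>W. g w * p w)" .
  have "\<Phi> \<in> M \<rightarrow>\<^sub>M count_space UNIV" using \<Phi> by (rule measurable_simple_function)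
  then have [measurable]: "(\<lambda>x. p (\<Phi> x)) \<in> borel_measurable M"
    by (rule measurable_compose) simp
  have "(\<integral>\<^sup>+x. (if p (\<Phi> x) = 0 then 1 else 0) \<partial>M) = 0"
    by (subst nn) (auto intro!: sum.neutral)
  then show "AE x in M. p (\<Phi> x) \<noteq> 0"
    by (subst (asm) nn_integral_0_iff_AE) auto
qed

text \<open>
  The finite duality applies to the laws of a simple function \<open>\<Phi>\<close>. A coupling of these laws with
  cost at most \<open>S\<close> is spread over the cells of \<open>\<Phi>\<close> by product measures, and the price is the mean displacement of
  \<open>\<Phi>\<close> under both marginals.
\<close>

lemma kantorovich_duality_simple:
  fixes \<mu> \<nu> M :: "'x measure" and c :: "'x \<Rightarrow> 'x \<Rightarrow> real" and \<Phi> :: "'x \<Rightarrow> 'x"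
  assumes P: "prob_space \<mu>" "prob_space \<nu>" and sets_M: "sets \<mu> = sets M" "sets \<nu> = sets M"
    and c_meas [measurable]: "(\<lambda>(x, y). c x y) \<in> borel_measurable (M \<Otimes>\<^sub>M M)"
    and c_refl: "\<And>x. x \<in> space M \<Longrightarrow> c x x = 0"
    and sym: "\<And>x y. x \<in> space M \<Longrightarrow> y \<in> space M \<Longrightarrow> c x y = c y x"
    and tri: "\<And>x y z. x \<in> space M \<Longrightarrow> y \<in> space M \<Longrightarrow> z \<in> space M \<Longrightarrow> c x z \<le> c x y + c y z"
    and nonneg: "\<And>x y. x \<in> space M \<Longrightarrow> y \<in> space M \<Longrightarrow> 0 \<le> c x y"
    and simple: "simple_function M \<Phi>" and \<Phi>_space: "\<And>x. x \<in> space M \<Longrightarrow> \<Phi> x \<in> space M"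
    and bound: "\<And>f. (\<And>x y. x \<in> space M \<Longrightarrow> y \<in> space M \<Longrightarrow> \<bar>f x - f y\<bar> \<le> c x y) \<Longrightarrow>
      (\<integral>x. f (\<Phi> x) \<partial>\<mu>) - (\<integral>x. f (\<Phi> x) \<partial>\<nu>) \<le> S"
  shows "transport_dist c \<mu> \<nu> \<le>
    ennreal S + (\<integral>\<^sup>+x. ennreal (c x (\<Phi> x)) \<partial>\<mu>) + (\<integral>\<^sup>+x. ennreal (c (\<Phi> x) x) \<partial>\<nu>)"
proof -
  interpret \<mu>: prob_space \<mu> by (rule P)
  interpret \<nu>: prob_space \<nu> by (rule P)
  interpret pair_sigma_finite \<mu> \<nu> ..
  note sets_M [measurable_cong]
  have space: "space \<mu> = space M" "space \<nu> = space M" using sets_M by (auto dest: sets_eq_imp_space_eq)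
  define W where "W = \<Phi> ` space M"
  have W: "finite W" "W \<noteq> {}" "W \<subseteq> space M"
    using simple \<mu>.not_empty \<Phi>_space by (auto simp: W_def simple_function_def space)
  have \<Phi>_W: "\<Phi> x \<in> W" if "x \<in> space M" for x using that by (simp add: W_def)
  have simple': "simple_function \<mu> \<Phi>" "simple_function \<nu> \<Phi>"
    using simple by (auto simp: simple_function_def space sets_M)
  have \<Phi>_count: "\<Phi> \<in> M \<rightarrow>\<^sub>M count_space UNIV"
    by (rule measurable_simple_function[OF simple])
  have \<Phi>_M [measurable]: "\<Phi> \<in> M \<rightarrow>\<^sub>M M"
    using simple \<Phi>_space by (auto simp: simple_function_def measurable_def intro!: simple_functionD)
  define p p' where "p w = measure \<mu> (\<Phi> -` {w} \<inter> space M)"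
    and "p' w = measure \<nu> (\<Phi> -` {w} \<inter> space M)" for w
  \<comment> \<open>Integrals of functions that are constant on the cells of the partition.\<close>
  note int_\<mu> = \<mu>.nn_integral_simple_function_law[OF simple'(1), unfolded space, folded W_def, folded p_def]
  note real_\<mu> = \<mu>.integral_simple_function_law[OF simple'(1), unfolded space, folded W_def, folded p_def]
  note AE_p = \<mu>.AE_simple_function_law[OF simple'(1), unfolded space, folded p_def]
  note int_\<nu> = \<nu>.nn_integral_simple_function_law[OF simple'(2), unfolded space, folded W_def, folded p'_def]
  note real_\<nu> = \<nu>.integral_simple_function_law[OF simple'(2), unfolded space, folded W_def, folded p'_def]
  note AE_p' = \<nu>.AE_simple_function_law[OF simple'(2), unfolded space, folded p'_def]
  have p: "sum p W = 1" "sum p' W = 1"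
    using real_\<mu>[of "\<lambda>_. 1"] real_\<nu>[of "\<lambda>_. 1"] by (simp_all add: \<mu>.prob_space \<nu>.prob_space)
  obtain m where m_nonneg: "\<And>i j. i \<in> W \<Longrightarrow> j \<in> W \<Longrightarrow> 0 \<le> m i j"
    and m_row: "\<And>i. i \<in> W \<Longrightarrow> (\<Sum>j\<in>W. m i j) = p i"
    and m_col: "\<And>j. j \<in> W \<Longrightarrow> (\<Sum>i\<in>W. m i j) = p' j"
    and m_cost: "(\<Sum>i\<in>W. \<Sum>j\<in>W. m i j * c i j) \<le> S"
  proof (rule finite_kantorovich_duality[of W c p p' S])
    fix f :: "'x \<Rightarrow> real" assume f: "\<And>i j. i \<in> W \<Longrightarrow> j \<in> W \<Longrightarrow> \<bar>f i - f j\<bar> \<le> c i j"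
    \<comment> \<open>McShane's extension of \<open>f\<close>\<close>
    define g where "g x = (MIN w\<in>W. f w + c x w)" for x
    have g_le: "g x \<le> f w + c x w" if "w \<in> W" for x w
      unfolding g_def using W that by (intro Min_le) auto
    have g_ex: "\<exists>w\<in>W. g x = f w + c x w" for x
    proof -
      have "g x \<in> (\<lambda>w. f w + c x w) ` W" unfolding g_def using W by (intro Min_in) auto
      then show ?thesis by blast
    qed
    have diff: "g x - g y \<le> c x y" if "x \<in> space M" "y \<in> space M" for x y
    proof -
      obtain w where w: "w \<in> W" "g y = f w + c y w" using g_ex by blast
      then show ?thesis using g_le[OF w(1), of x] tri[of x y w] that W(3) by auto
    qed
    have "\<bar>g x - g y\<bar> \<le> c x y" if "x \<in> space M" "y \<in> space M" for x y
      using diff[OF that] diff[OF that(2,1)] sym[OF that] by linarith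
    then have "(\<integral>x. g (\<Phi> x) \<partial>\<mu>) - (\<integral>x. g (\<Phi> x) \<partial>\<nu>) \<le> S" by (rule bound)
    moreover have "g w = f w" if w: "w \<in> W" for w
    proof -
      obtain w' where w': "w' \<in> W" "g w = f w' + c w w'" using g_ex by blast
      then show ?thesis using g_le[OF w, of w] f[OF w w'(1)] c_refl[of w] w W(3) by auto
    qed
    ultimately show "(\<Sum>i\<in>W. f i * p i) - (\<Sum>i\<in>W. f i * p' i) \<le> S"
      by (simp add: real_\<mu> real_\<nu>)
  qed (use W c_refl sym tri p in \<open>auto simp: p_def p'_def subset_iff\<close>)
  have m_zero: "m i j = 0" if "i \<in> W" "j \<in> W" "p i = 0 \<or> p' j = 0" for i j
    using that m_row[of i] m_col[of j] m_nonneg W(1)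
      sum_nonneg_eq_0_iff[of W "m i"] sum_nonneg_eq_0_iff[of W "\<lambda>i. m i j"] by auto
  have p_nonneg: "0 \<le> p i" "0 \<le> p' i" for i by (auto simp: p_def p'_def)
  \<comment> \<open>Inside a pair of cells the coupling is a multiple of the product measure.\<close>
  define k where "k i j = (if i \<in> W \<and> j \<in> W then m i j / (p i * p' j) else 0)" for i j
  define \<gamma> where "\<gamma> = density (\<mu> \<Otimes>\<^sub>M \<nu>) (\<lambda>(x, y). ennreal (k (\<Phi> x) (\<Phi> y)))"
  have k_nonneg: "0 \<le> k i j" for i j
    using m_nonneg p_nonneg by (auto simp: k_def)
  have k_mult: "k i j * p i * p' j = m i j" if "i \<in> W" "j \<in> W" for i j
    using m_zero[OF that] that by (auto simp: k_def)
  have [measurable]: "(\<lambda>x. case x of (x, y) \<Rightarrow> ennreal (k (\<Phi> x) (\<Phi> y))) \<in> borel_measurable (M \<Otimes>\<^sub>M M)"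
  proof -
    have "(\<lambda>x. (\<Phi> (fst x), \<Phi> (snd x))) \<in> M \<Otimes>\<^sub>M M \<rightarrow>\<^sub>M count_space (W \<times> W)"
    proof (subst pair_measure_countable[symmetric])
      have "\<Phi> \<in> M \<rightarrow>\<^sub>M count_space W"
        using simple \<Phi>_W by (auto simp: simple_function_def measurable_def intro!: simple_functionD)
      then show "(\<lambda>x. (\<Phi> (fst x), \<Phi> (snd x))) \<in> M \<Otimes>\<^sub>M M \<rightarrow>\<^sub>M count_space W \<Otimes>\<^sub>M count_space W"
        by measurable
    qed (use W in \<open>auto intro: countable_finite\<close>)
    from measurable_compose[OF this, of "\<lambda>(i, j). ennreal (k i j)" borel]
    show ?thesis by (simp add: case_prod_unfold)
  qed
  have [measurable]: "(\<lambda>y. ennreal (k i (\<Phi> y))) \<in> borel_measurable M"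
    "(\<lambda>x. ennreal (k (\<Phi> x) i)) \<in> borel_measurable M" for i
    using measurable_compose[OF \<Phi>_count, of "\<lambda>j. ennreal (k i j)" borel]
      measurable_compose[OF \<Phi>_count, of "\<lambda>j. ennreal (k j i)" borel] by simp_all
  have nn_\<gamma>: "(\<integral>\<^sup>+z. F z \<partial>\<gamma>) = (\<integral>\<^sup>+x. \<integral>\<^sup>+y. ennreal (k (\<Phi> x) (\<Phi> y)) * F (x, y) \<partial>\<nu> \<partial>\<mu>)"
    and nn_\<gamma>': "(\<integral>\<^sup>+z. F z \<partial>\<gamma>) = (\<integral>\<^sup>+y. \<integral>\<^sup>+x. ennreal (k (\<Phi> x) (\<Phi> y)) * F (x, y) \<partial>\<mu> \<partial>\<nu>)"
    if [measurable]: "F \<in> borel_measurable (M \<Otimes>\<^sub>M M)" for F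
  proof -
    define H where "H z = (case z of (x, y) \<Rightarrow> ennreal (k (\<Phi> x) (\<Phi> y))) * F z" for z
    have H: "H \<in> borel_measurable (\<mu> \<Otimes>\<^sub>M \<nu>)" unfolding H_def by measurable
    have "(\<integral>\<^sup>+z. F z \<partial>\<gamma>) = (\<integral>\<^sup>+z. H z \<partial>(\<mu> \<Otimes>\<^sub>M \<nu>))"
      unfolding \<gamma>_def H_def by (rule nn_integral_density) measurable
    with \<nu>.nn_integral_fst[OF H] nn_integral_snd[OF H]
    show "(\<integral>\<^sup>+z. F z \<partial>\<gamma>) = (\<integral>\<^sup>+x. \<integral>\<^sup>+y. ennreal (k (\<Phi> x) (\<Phi> y)) * F (x, y) \<partial>\<nu> \<partial>\<mu>)"
      and "(\<integral>\<^sup>+z. F z \<partial>\<gamma>) = (\<integral>\<^sup>+y. \<integral>\<^sup>+x. ennreal (k (\<Phi> x) (\<Phi> y)) * F (x, y) \<partial>\<mu> \<partial>\<nu>)"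
      by (simp_all add: H_def[abs_def])
  qed
  have row: "(\<integral>\<^sup>+y. ennreal (k i (\<Phi> y)) \<partial>\<nu>) = 1" if i: "i \<in> W" "p i \<noteq> 0" for i
  proof -
    have "(\<integral>\<^sup>+y. ennreal (k i (\<Phi> y)) \<partial>\<nu>) = ennreal (\<Sum>j\<in>W. k i j * p' j)"
      using k_nonneg p_nonneg int_\<nu>[of "\<lambda>j. ennreal (k i j)"] by (simp add: ennreal_mult'[symmetric])
    also have "(\<Sum>j\<in>W. k i j * p' j) = (\<Sum>j\<in>W. m i j / p i)"
      using k_mult[OF i(1)] i by (intro sum.cong) (auto simp: field_simps)
    also have "\<dots> = 1" using m_row[OF i(1)] i by (simp flip: sum_divide_distrib)
    finally show ?thesis by simp
  qed
  have col: "(\<integral>\<^sup>+x. ennreal (k (\<Phi> x) j) \<partial>\<mu>) = 1" if j: "j \<in> W" "p' j \<noteq> 0" for j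
  proof -
    have "(\<integral>\<^sup>+x. ennreal (k (\<Phi> x) j) \<partial>\<mu>) = ennreal (\<Sum>i\<in>W. k i j * p i)"
      using k_nonneg p_nonneg int_\<mu>[of "\<lambda>i. ennreal (k i j)"] by (simp add: ennreal_mult'[symmetric])
    also have "(\<Sum>i\<in>W. k i j * p i) = (\<Sum>i\<in>W. m i j / p' j)"
      using k_mult[OF _ j(1)] j by (intro sum.cong) (auto simp: field_simps)
    also have "\<dots> = 1" using m_col[OF j(1)] j by (simp flip: sum_divide_distrib)
    finally show ?thesis by simp
  qed
  have nn_fst: "(\<integral>\<^sup>+z. F (fst z) \<partial>\<gamma>) = (\<integral>\<^sup>+x. F x \<partial>\<mu>)" if [measurable]: "F \<in> borel_measurable M" for F
  proof -
    have "(\<integral>\<^sup>+z. F (fst z) \<partial>\<gamma>) = (\<integral>\<^sup>+x. (\<integral>\<^sup>+y. ennreal (k (\<Phi> x) (\<Phi> y)) \<partial>\<nu>) * F x \<partial>\<mu>)"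
      by (subst nn_\<gamma>) (auto simp: nn_integral_multc measurable_cong_sets[OF sets_M(2)])
    also have "\<dots> = (\<integral>\<^sup>+x. F x \<partial>\<mu>)"
      using AE_p by (intro nn_integral_cong_AE) (auto simp: row \<Phi>_W space)
    finally show ?thesis .
  qed
  have nn_snd: "(\<integral>\<^sup>+z. F (snd z) \<partial>\<gamma>) = (\<integral>\<^sup>+x. F x \<partial>\<nu>)" if [measurable]: "F \<in> borel_measurable M" for F
  proof -
    have "(\<integral>\<^sup>+z. F (snd z) \<partial>\<gamma>) = (\<integral>\<^sup>+y. (\<integral>\<^sup>+x. ennreal (k (\<Phi> x) (\<Phi> y)) \<partial>\<mu>) * F y \<partial>\<nu>)"
      by (subst nn_\<gamma>') (auto simp: nn_integral_multc measurable_cong_sets[OF sets_M(1)])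
    also have "\<dots> = (\<integral>\<^sup>+x. F x \<partial>\<nu>)"
      using AE_p' by (intro nn_integral_cong_AE) (auto simp: col \<Phi>_W space)
    finally show ?thesis .
  qed
  have sets_\<gamma> [measurable_cong]: "sets \<gamma> = sets (M \<Otimes>\<^sub>M M)"
    by (simp add: \<gamma>_def sets_M cong: sets_pair_measure_cong)
  have "distr \<gamma> \<mu> fst = \<mu>"
  proof (rule measure_eqI)
    fix A assume "A \<in> sets (distr \<gamma> \<mu> fst)"
    then have [measurable]: "A \<in> sets M" by (simp add: sets_M)
    have "emeasure (distr \<gamma> \<mu> fst) A = (\<integral>\<^sup>+z. indicator A z \<partial>distr \<gamma> \<mu> fst)"
      by (simp add: sets_M)
    also have "\<dots> = (\<integral>\<^sup>+z. indicator A (fst z) \<partial>\<gamma>)" by (rule nn_integral_distr) measurable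
    also have "\<dots> = emeasure \<mu> A" by (simp add: nn_fst sets_M)
    finally show "emeasure (distr \<gamma> \<mu> fst) A = emeasure \<mu> A" .
  qed simp
  moreover have "distr \<gamma> \<nu> snd = \<nu>"
  proof (rule measure_eqI)
    fix A assume "A \<in> sets (distr \<gamma> \<nu> snd)"
    then have [measurable]: "A \<in> sets M" by (simp add: sets_M)
    have "emeasure (distr \<gamma> \<nu> snd) A = (\<integral>\<^sup>+z. indicator A z \<partial>distr \<gamma> \<nu> snd)"
      by (simp add: sets_M)
    also have "\<dots> = (\<integral>\<^sup>+z. indicator A (snd z) \<partial>\<gamma>)" by (rule nn_integral_distr) measurable
    also have "\<dots> = emeasure \<nu> A" by (simp add: nn_snd sets_M)
    finally show "emeasure (distr \<gamma> \<nu> snd) A = emeasure \<nu> A" .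
  qed simp
  ultimately have coupling: "\<gamma> \<in> couplings \<mu> \<nu>"
    by (simp add: couplings_def \<gamma>_def)
  have [measurable]: "(\<lambda>x. c x (\<Phi> x)) \<in> borel_measurable M" "(\<lambda>x. c (\<Phi> x) x) \<in> borel_measurable M"
    using measurable_compose[OF _ c_meas, of "\<lambda>x. (x, \<Phi> x)" M]
      measurable_compose[OF _ c_meas, of "\<lambda>x. (\<Phi> x, x)" M] by simp_all
  have [measurable]: "(\<lambda>z. c (\<Phi> (fst z)) (\<Phi> (snd z))) \<in> borel_measurable (M \<Otimes>\<^sub>M M)"
    using measurable_compose[OF _ c_meas, of "\<lambda>z. (\<Phi> (fst z), \<Phi> (snd z))" "M \<Otimes>\<^sub>M M"] by simp
  have cost_cells: "(\<integral>\<^sup>+z. ennreal (c (\<Phi> (fst z)) (\<Phi> (snd z))) \<partial>\<gamma>) \<le> ennreal S"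
  proof -
    have "(\<integral>\<^sup>+z. ennreal (c (\<Phi> (fst z)) (\<Phi> (snd z))) \<partial>\<gamma>)
        = (\<integral>\<^sup>+x. \<integral>\<^sup>+y. ennreal (k (\<Phi> x) (\<Phi> y)) * ennreal (c (\<Phi> x) (\<Phi> y)) \<partial>\<nu> \<partial>\<mu>)"
      by (subst nn_\<gamma>) simp_all
    also have "\<dots> = (\<integral>\<^sup>+x. (\<Sum>j\<in>W. ennreal (k (\<Phi> x) j) * ennreal (c (\<Phi> x) j) * ennreal (p' j)) \<partial>\<mu>)"
      by (intro nn_integral_cong int_\<nu>)
    also have "\<dots> = (\<Sum>i\<in>W. (\<Sum>j\<in>W. ennreal (k i j) * ennreal (c i j) * ennreal (p' j)) * ennreal (p i))"
      by (rule int_\<mu>)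
    also have "\<dots> = (\<Sum>i\<in>W. \<Sum>j\<in>W. ennreal (m i j * c i j))"
    proof (intro sum.cong refl)
      fix i assume i: "i \<in> W"
      have "ennreal (k i j) * ennreal (c i j) * ennreal (p' j) * ennreal (p i) = ennreal (m i j * c i j)"
        if j: "j \<in> W" for j
      proof -
        have "ennreal (k i j) * ennreal (c i j) * ennreal (p' j) * ennreal (p i)
            = ennreal (k i j * c i j * p' j * p i)"
          using k_nonneg p_nonneg nonneg[of i j] i j W(3) by (simp add: ennreal_mult subset_iff)
        also have "k i j * c i j * p' j * p i = m i j * c i j"
          using k_mult[OF i j] by (simp add: mult_ac)
        finally show ?thesis .
      qed
      then show "(\<Sum>j\<in>W. ennreal (k i j) * ennreal (c i j) * ennreal (p' j)) * ennreal (p i)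
          = (\<Sum>j\<in>W. ennreal (m i j * c i j))"
        by (simp add: sum_distrib_right)
    qed
    also have "\<dots> = ennreal (\<Sum>i\<in>W. \<Sum>j\<in>W. m i j * c i j)"
    proof -
      have "0 \<le> m i j * c i j" if "i \<in> W" "j \<in> W" for i j
        using m_nonneg nonneg that W(3) by (auto simp: subset_iff)
      then show ?thesis by (simp add: sum_nonneg cong: sum.cong)
    qed
    also have "\<dots> \<le> ennreal S" by (rule ennreal_leI[OF m_cost])
    finally show ?thesis .
  qed
  have "transport_dist c \<mu> \<nu> \<le> (\<integral>\<^sup>+(x, y). ennreal (c x y) \<partial>\<gamma>)"
    unfolding transport_dist_def by (rule INF_lower[OF coupling])
  also have "\<dots> \<le> (\<integral>\<^sup>+z. ennreal (c (fst z) (\<Phi> (fst z))) + ennreal (c (\<Phi> (fst z)) (\<Phi> (snd z)))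
      + ennreal (c (\<Phi> (snd z)) (snd z)) \<partial>\<gamma>)"
  proof (intro nn_integral_mono)
    have "space \<gamma> = space M \<times> space M"
      by (simp add: \<gamma>_def space_pair_measure space)
    moreover fix z assume "z \<in> space \<gamma>"
    ultimately have z: "fst z \<in> space M" "snd z \<in> space M"
      by (simp_all add: mem_Times_iff)
    have "c (fst z) (snd z) \<le> c (fst z) (\<Phi> (fst z)) + c (\<Phi> (fst z)) (\<Phi> (snd z)) + c (\<Phi> (snd z)) (snd z)"
      using tri[of "fst z" "\<Phi> (fst z)" "snd z"] tri[of "\<Phi> (fst z)" "\<Phi> (snd z)" "snd z"] z \<Phi>_space by simp
    then show "(case z of (x, y) \<Rightarrow> ennreal (c x y)) \<le> ennreal (c (fst z) (\<Phi> (fst z)))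
        + ennreal (c (\<Phi> (fst z)) (\<Phi> (snd z))) + ennreal (c (\<Phi> (snd z)) (snd z))"
      using z \<Phi>_space nonneg by (simp add: case_prod_unfold ennreal_plus[symmetric] del: ennreal_plus)
  qed
  also have "\<dots> = (\<integral>\<^sup>+x. ennreal (c x (\<Phi> x)) \<partial>\<mu>)
      + (\<integral>\<^sup>+z. ennreal (c (\<Phi> (fst z)) (\<Phi> (snd z))) \<partial>\<gamma>) + (\<integral>\<^sup>+x. ennreal (c (\<Phi> x) x) \<partial>\<nu>)"
  proof -
    have "(\<lambda>z. ennreal (c (fst z) (\<Phi> (fst z)))) \<in> borel_measurable \<gamma>"
      "(\<lambda>z. ennreal (c (\<Phi> (snd z)) (snd z))) \<in> borel_measurable \<gamma>"
      using measurable_compose[OF measurable_fst, of "\<lambda>x. ennreal (c x (\<Phi> x))" M borel]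
        measurable_compose[OF measurable_snd, of "\<lambda>x. ennreal (c (\<Phi> x) x)" M borel] by measurable
    then show ?thesis
      using nn_fst[of "\<lambda>x. ennreal (c x (\<Phi> x))"] nn_snd[of "\<lambda>x. ennreal (c (\<Phi> x) x)"]
      by (simp add: nn_integral_add)
  qed
  also have "\<dots> \<le> (\<integral>\<^sup>+x. ennreal (c x (\<Phi> x)) \<partial>\<mu>) + ennreal S + (\<integral>\<^sup>+x. ennreal (c (\<Phi> x) x) \<partial>\<nu>)"
    using cost_cells by (intro add_mono) auto
  finally show ?thesis by (simp add: add_ac)
qed


text \<open>
  A Lipschitz function is the pointwise limit of its compositions with \<open>\<Phi> n\<close>, which
  take finitely many values. In this way measurability for the product \<open>\<sigma>\<close>-algebra follows without
  a comparison with the Borel sets of a product topology.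
\<close>

lemma measurable_lipschitz_approx:
  fixes f :: "'x \<Rightarrow> real"
  assumes lip: "\<And>x y. x \<in> space M \<Longrightarrow> y \<in> space M \<Longrightarrow> \<bar>f x - f y\<bar> \<le> c x y"
    and simple: "\<And>n. simple_function M (\<Phi> n)"
    and \<Phi>_space: "\<And>n x. x \<in> space M \<Longrightarrow> \<Phi> n x \<in> space M"
    and approx: "\<And>x. x \<in> space M \<Longrightarrow> (\<lambda>n. c x (\<Phi> n x)) \<longlonglongrightarrow> 0"
  shows "f \<in> borel_measurable M"
proof (rule borel_measurable_LIMSEQ_real)
  show "(\<lambda>n. f (\<Phi> n x)) \<longlonglongrightarrow> f x" if x: "x \<in> space M" for x
  proof -
    have "(\<lambda>n. f x - f (\<Phi> n x)) \<longlonglongrightarrow> 0"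
      using lip[OF x \<Phi>_space[OF x]] by (intro Lim_null_comparison[OF _ approx[OF x]]) auto
    from tendsto_diff[OF tendsto_const[of "f x"] this] show ?thesis by simp
  qed
  show "(\<lambda>x. f (\<Phi> n x)) \<in> borel_measurable M" for n
    using simple_function_compose1[OF simple] by (rule borel_measurable_simple_function)
qed

text \<open>
  Passage to the limit along simple functions that converge pointwise to the identity. Bounding the
  differences of integrals by \<open>S\<close> for all Lipschitz functions bounds the transportation cost by
  \<open>S\<close>; this is the hard direction of the duality.
\<close>

lemma kantorovich_duality:
  fixes \<mu> \<nu> M :: "'x measure" and c :: "'x \<Rightarrow> 'x \<Rightarrow> real" and \<Phi> :: "nat \<Rightarrow> 'x \<Rightarrow> 'x"
  assumes P: "prob_space \<mu>" "prob_space \<nu>" and sets_M: "sets \<mu> = sets M" "sets \<nu> = sets M"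
    and c_meas: "(\<lambda>(x, y). c x y) \<in> borel_measurable (M \<Otimes>\<^sub>M M)"
    and c_refl: "\<And>x. x \<in> space M \<Longrightarrow> c x x = 0"
    and sym: "\<And>x y. x \<in> space M \<Longrightarrow> y \<in> space M \<Longrightarrow> c x y = c y x"
    and tri: "\<And>x y z. x \<in> space M \<Longrightarrow> y \<in> space M \<Longrightarrow> z \<in> space M \<Longrightarrow> c x z \<le> c x y + c y z"
    and nonneg: "\<And>x y. x \<in> space M \<Longrightarrow> y \<in> space M \<Longrightarrow> 0 \<le> c x y"
    and le: "\<And>x y. x \<in> space M \<Longrightarrow> y \<in> space M \<Longrightarrow> c x y \<le> B"
    and simple: "\<And>n. simple_function M (\<Phi> n)"
    and \<Phi>_space: "\<And>n x. x \<in> space M \<Longrightarrow> \<Phi> n x \<in> space M"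
    and approx: "\<And>x. x \<in> space M \<Longrightarrow> (\<lambda>n. c x (\<Phi> n x)) \<longlonglongrightarrow> 0"
    and bound: "\<And>f. (\<And>x y. x \<in> space M \<Longrightarrow> y \<in> space M \<Longrightarrow> \<bar>f x - f y\<bar> \<le> c x y) \<Longrightarrow>
      (\<integral>x. f x \<partial>\<mu>) - (\<integral>x. f x \<partial>\<nu>) \<le> S"
  shows "transport_dist c \<mu> \<nu> \<le> ennreal S"
proof -
  interpret \<mu>: prob_space \<mu> by (rule P)
  interpret \<nu>: prob_space \<nu> by (rule P)
  have space: "space \<mu> = space M" "space \<nu> = space M" using sets_M by (auto dest: sets_eq_imp_space_eq)
  define e where "e n x = c x (\<Phi> n x)" for n x
  have e_bounds: "0 \<le> e n x" "e n x \<le> B" if "x \<in> space M" for n x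
    using that nonneg le \<Phi>_space by (auto simp: e_def)
  have e_meas: "e n \<in> borel_measurable M" for n
  proof -
    have "\<Phi> n \<in> M \<rightarrow>\<^sub>M M"
      using simple[of n] \<Phi>_space by (auto simp: simple_function_def measurable_def intro!: simple_functionD)
    then have "(\<lambda>x. (x, \<Phi> n x)) \<in> M \<rightarrow>\<^sub>M M \<Otimes>\<^sub>M M" by measurable
    from measurable_compose[OF this c_meas] show ?thesis by (simp add: e_def[abs_def])
  qed
  have f_meas: "f \<in> borel_measurable M"
    if "\<And>x y. x \<in> space M \<Longrightarrow> y \<in> space M \<Longrightarrow> \<bar>f x - f y\<bar> \<le> c x y" for f :: "'x \<Rightarrow> real"
    using that simple \<Phi>_space approx by (rule measurable_lipschitz_approx)
  have disc: "integrable N (e n)" "(\<lambda>n. \<integral>x. e n x \<partial>N) \<longlonglongrightarrow> 0"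
    "\<bar>(\<integral>x. f (\<Phi> n x) \<partial>N) - (\<integral>x. f x \<partial>N)\<bar> \<le> (\<integral>x. e n x \<partial>N)"
    if N: "prob_space N" "sets N = sets M"
      and f: "\<And>x y. x \<in> space M \<Longrightarrow> y \<in> space M \<Longrightarrow> \<bar>f x - f y\<bar> \<le> c x y" for N f n
  proof -
    interpret N: prob_space N by fact
    note N(2)[measurable_cong]
    have sp: "space N = space M" using N(2) by (rule sets_eq_imp_space_eq)
    have [measurable]: "e n \<in> borel_measurable N" for n using e_meas by measurable
    show int_e: "integrable N (e n)" for n
      using e_bounds by (intro N.integrable_const_bound[of _ B]) (auto simp: sp)
    have "(\<lambda>n. \<integral>x. e n x \<partial>N) \<longlonglongrightarrow> (\<integral>x. 0 \<partial>N)"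
      using e_bounds approx by (intro integral_dominated_convergence[where w="\<lambda>_. B"]) (auto simp: sp e_def[symmetric])
    then show "(\<lambda>n. \<integral>x. e n x \<partial>N) \<longlonglongrightarrow> 0" by simp
    have [measurable]: "f \<in> borel_measurable N"
      using f_meas[OF f] N(2) by measurable
    have [measurable]: "(\<lambda>x. f (\<Phi> n x)) \<in> borel_measurable N"
      using borel_measurable_simple_function[OF simple_function_compose1[OF simple[of n], of f]]
      by measurable
    obtain x0 where x0: "x0 \<in> space M" using N.not_empty sp by blast
    have f_bound: "\<bar>f x\<bar> \<le> \<bar>f x0\<bar> + B" if "x \<in> space M" for x
      using f[OF that x0] le[OF that x0] by linarith
    have int_f: "integrable N f" "integrable N (\<lambda>x. f (\<Phi> n x))"
      using f_bound \<Phi>_space by (auto intro!: N.integrable_const_bound[of _ "\<bar>f x0\<bar> + B"] simp: sp)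
    have "\<bar>(\<integral>x. f (\<Phi> n x) \<partial>N) - (\<integral>x. f x \<partial>N)\<bar> = \<bar>\<integral>x. f (\<Phi> n x) - f x \<partial>N\<bar>"
      using int_f by simp
    also have "\<dots> \<le> (\<integral>x. \<bar>f (\<Phi> n x) - f x\<bar> \<partial>N)" by (rule integral_abs_bound)
    also have "\<dots> \<le> (\<integral>x. e n x \<partial>N)"
    proof (intro integral_mono integrable_abs Bochner_Integration.integrable_diff int_f int_e)
      fix x assume "x \<in> space N"
      then show "\<bar>f (\<Phi> n x) - f x\<bar> \<le> e n x"
        using f[of x "\<Phi> n x"] \<Phi>_space[of x n] by (simp add: sp e_def abs_minus_commute)
    qed
    finally show "\<bar>(\<integral>x. f (\<Phi> n x) \<partial>N) - (\<integral>x. f x \<partial>N)\<bar> \<le> (\<integral>x. e n x \<partial>N)" .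
  qed
  have S: "0 \<le> S" using bound[of "\<lambda>_. 0"] nonneg by simp
  define s where "s n = (\<integral>x. e n x \<partial>\<mu>) + (\<integral>x. e n x \<partial>\<nu>)" for n
  have "transport_dist c \<mu> \<nu> \<le> ennreal (S + 2 * s n)" for n
  proof -
    have "transport_dist c \<mu> \<nu> \<le> ennreal (S + s n)
        + (\<integral>\<^sup>+x. ennreal (c x (\<Phi> n x)) \<partial>\<mu>) + (\<integral>\<^sup>+x. ennreal (c (\<Phi> n x) x) \<partial>\<nu>)"
    proof (rule kantorovich_duality_simple[OF P sets_M c_meas c_refl sym tri nonneg simple \<Phi>_space])
      fix f :: "'x \<Rightarrow> real"
      assume f: "\<And>x y. x \<in> space M \<Longrightarrow> y \<in> space M \<Longrightarrow> \<bar>f x - f y\<bar> \<le> c x y"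
      show "(\<integral>x. f (\<Phi> n x) \<partial>\<mu>) - (\<integral>x. f (\<Phi> n x) \<partial>\<nu>) \<le> S + s n"
        using disc(3)[OF P(1) sets_M(1) f, of n] disc(3)[OF P(2) sets_M(2) f, of n] bound[OF f]
        by (simp add: s_def)
    qed
    also have "(\<integral>\<^sup>+x. ennreal (c x (\<Phi> n x)) \<partial>\<mu>) = ennreal (\<integral>x. e n x \<partial>\<mu>)"
      using disc(1)[OF P(1) sets_M(1), of "\<lambda>_. 0" n] nonneg e_bounds
      by (subst nn_integral_eq_integral[symmetric]) (auto simp: space e_def[symmetric])
    also have "(\<integral>\<^sup>+x. ennreal (c (\<Phi> n x) x) \<partial>\<nu>) = ennreal (\<integral>x. e n x \<partial>\<nu>)"
    proof -
      have "(\<integral>\<^sup>+x. ennreal (c (\<Phi> n x) x) \<partial>\<nu>) = (\<integral>\<^sup>+x. ennreal (e n x) \<partial>\<nu>)"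
        using sym \<Phi>_space by (intro nn_integral_cong) (simp add: space e_def)
      then show ?thesis
        using disc(1)[OF P(2) sets_M(2), of "\<lambda>_. 0" n] nonneg e_bounds
        by (subst nn_integral_eq_integral[symmetric]) (auto simp: space)
    qed
    also have "ennreal (S + s n) + ennreal (\<integral>x. e n x \<partial>\<mu>) + ennreal (\<integral>x. e n x \<partial>\<nu>)
        = ennreal (S + 2 * s n)"
    proof -
      have "0 \<le> (\<integral>x. e n x \<partial>\<mu>)" "0 \<le> (\<integral>x. e n x \<partial>\<nu>)"
        using e_bounds by (auto intro!: Bochner_Integration.integral_nonneg simp: space)
      then show ?thesis using S by (simp add: s_def ennreal_plus[symmetric] del: ennreal_plus)
    qed
    finally show ?thesis .
  qed
  moreover have "(\<lambda>n. ennreal (S + 2 * s n)) \<longlonglongrightarrow> ennreal (S + 2 * (0 + 0))"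
    unfolding s_def
    by (intro tendsto_intros disc(2)[OF P(1) sets_M(1), of "\<lambda>_. 0"] disc(2)[OF P(2) sets_M(2), of "\<lambda>_. 0"])
      (use nonneg in auto)
  ultimately show ?thesis by (intro LIMSEQ_le_const) auto
qed


section \<open>The Gibbs variational inequality\<close>

text \<open>
  With \<open>h\<close> the entropy density, the inequality \<open>u \<le> exp u - 1\<close> at \<open>u = g - h - c\<close> is integrated
  against \<open>\<mu>\<close>. The change of measure turns the exponential into at most
  \<open>exp (- c)\<close> times the exponential moment of \<open>g\<close> under \<open>\<nu>\<close>.
\<close>

lemma gibbs_variational_inequality:
  fixes g :: "'x \<Rightarrow> real"
  assumes P: "prob_space \<mu>" "prob_space \<nu>" and sets_eq: "sets \<mu> = sets \<nu>"
    and g [measurable]: "g \<in> borel_measurable \<nu>" and int_g: "integrable \<mu> g"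
    and exp_g: "(\<integral>\<^sup>+ x. ennreal (exp (g x)) \<partial>\<nu>) \<le> ennreal (exp c)"
  shows "ereal (\<integral>x. g x \<partial>\<mu>) \<le> rel_entropy \<mu> \<nu> + ereal c"
proof (cases "absolutely_continuous \<nu> \<mu>")
  case False
  then show ?thesis by (simp add: rel_entropy_def)
next
  case ac: True
  interpret \<mu>: prob_space \<mu> by (rule P)
  interpret \<nu>: prob_space \<nu> by (rule P)
  note sets_eq [measurable_cong]
  define R where "R x = enn2real (RN_deriv \<nu> \<mu> x)" for x
  have R_meas [measurable]: "R \<in> borel_measurable \<nu>" unfolding R_def by measurable
  have R_nonneg: "0 \<le> R x" for x by (simp add: R_def)
  have "AE x in \<nu>. RN_deriv \<nu> \<mu> x \<noteq> \<infinity>"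
    by (intro \<nu>.RN_deriv_finite ac sets_eq) unfold_locales
  then have "density \<nu> (\<lambda>x. ennreal (R x)) = density \<nu> (RN_deriv \<nu> \<mu>)"
    by (intro density_cong) (auto simp: R_def less_top)
  then have \<mu>_eq: "\<mu> = density \<nu> (\<lambda>x. ennreal (R x))"
    using \<nu>.density_RN_deriv[OF ac sets_eq] by simp
  have nn_\<mu>: "(\<integral>\<^sup>+x. f x \<partial>\<mu>) = (\<integral>\<^sup>+x. ennreal (R x) * f x \<partial>\<nu>)"
    if [measurable]: "f \<in> borel_measurable \<nu>" for f
    by (subst \<mu>_eq) (simp add: nn_integral_density)
  define h where "h = entropy_density (exp 1) \<nu> \<mu>"
  have h: "h x = ln (R x)" for x by (simp add: h_def entropy_density_def R_def log_def)
  have [measurable]: "h \<in> borel_measurable \<nu>" unfolding h by measurable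
  \<comment> \<open>From \<open>ln u \<le> u - 1\<close> at \<open>u = 1 / R\<close>; hence the negative part of \<open>h\<close> is always
      integrable, and only the positive part can make the entropy infinite.\<close>
  have neg_bound: "R x * - ln (R x) \<le> 1" for x
  proof (cases "R x = 0")
    case False
    then have pos: "0 < R x" using R_nonneg[of x] by simp
    have "R x * - ln (R x) = R x * ln (1 / R x)" using pos by (simp add: ln_div)
    also have "\<dots> \<le> R x * (1 / R x - 1)"
      using pos ln_le_minus_one[of "1 / R x"] by (intro mult_left_mono) auto
    also have "\<dots> \<le> 1" using pos by (simp add: field_simps)
    finally show ?thesis .
  qed simp
  have "(\<integral>\<^sup>+ x. ennreal (- h x) \<partial>\<mu>) = (\<integral>\<^sup>+ x. ennreal (R x) * ennreal (- h x) \<partial>\<nu>)"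
    by (intro nn_\<mu>) measurable
  also have "\<dots> \<le> (\<integral>\<^sup>+ x. 1 \<partial>\<nu>)"
    using neg_bound R_nonneg
    by (intro nn_integral_mono) (simp add: h ennreal_mult'[symmetric] ennreal_le_1)
  finally have neg_le: "(\<integral>\<^sup>+ x. ennreal (- h x) \<partial>\<mu>) \<le> 1"
    by (simp add: \<nu>.emeasure_space_1)
  show ?thesis
  proof (cases "(\<integral>\<^sup>+ x. ennreal (h x) \<partial>\<mu>) = \<infinity>")
    case True
    have "enn2ereal (\<integral>\<^sup>+ x. ennreal (- h x) \<partial>\<mu>) \<noteq> \<infinity>"
      using neg_le by (auto simp: top_unique)
    then have "rel_entropy \<mu> \<nu> = \<infinity>"
      using True ac unfolding rel_entropy_def h_def[symmetric] by simp
    then show ?thesis by simp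
  next
    case False
    have int_h: "integrable \<mu> h"
      using False neg_le by (auto simp: real_integrable_def top_unique)
    have ent: "rel_entropy \<mu> \<nu> = ereal (\<integral>x. h x \<partial>\<mu>)"
    proof -
      have "(\<integral>\<^sup>+ x. ennreal (- h x) \<partial>\<mu>) \<noteq> \<infinity>" using neg_le by (auto simp: top_unique)
      with False show ?thesis
        using ac real_lebesgue_integral_def[OF int_h] unfolding rel_entropy_def h_def[symmetric]
        by (cases "\<integral>\<^sup>+ x. ennreal (h x) \<partial>\<mu>"; cases "\<integral>\<^sup>+ x. ennreal (- h x) \<partial>\<mu>") auto
    qed
    have "(\<integral>\<^sup>+ x. ennreal (exp (g x - h x - c)) \<partial>\<mu>)
        = (\<integral>\<^sup>+ x. ennreal (R x) * ennreal (exp (g x - h x - c)) \<partial>\<nu>)"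
      by (intro nn_\<mu>) measurable
    also have "\<dots> \<le> (\<integral>\<^sup>+ x. ennreal (exp (- c)) * ennreal (exp (g x)) \<partial>\<nu>)"
    proof (intro nn_integral_mono)
      fix x
      have "R x * exp (g x - h x - c) \<le> exp (- c) * exp (g x)"
        using R_nonneg[of x] by (cases "R x = 0") (auto simp: h exp_diff exp_minus exp_add field_simps less_le)
      then show "ennreal (R x) * ennreal (exp (g x - h x - c)) \<le> ennreal (exp (- c)) * ennreal (exp (g x))"
        using R_nonneg by (simp add: ennreal_mult'[symmetric])
    qed
    also have "\<dots> \<le> ennreal (exp (- c)) * ennreal (exp c)"
      using exp_g by (subst nn_integral_cmult) (auto intro: mult_left_mono)
    also have "\<dots> = 1"
      by (simp add: ennreal_mult'[symmetric] exp_add[symmetric])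
    finally have exp_le: "(\<integral>\<^sup>+ x. ennreal (exp (g x - h x - c)) \<partial>\<mu>) \<le> 1" .
    have int_exp: "integrable \<mu> (\<lambda>x. exp (g x - h x - c))"
      using exp_le by (intro integrableI_nonneg) (auto simp: less_top[symmetric] top_unique)
    have "(\<integral>x. g x - h x - c \<partial>\<mu>) \<le> (\<integral>x. exp (g x - h x - c) - 1 \<partial>\<mu>)"
    proof (intro integral_mono)
      fix x
      show "g x - h x - c \<le> exp (g x - h x - c) - 1"
        using exp_ge_add_one_self[of "g x - h x - c"] by linarith
    qed (use int_exp int_g int_h in auto)
    also have "\<dots> \<le> 0"
    proof -
      have "ennreal (\<integral>x. exp (g x - h x - c) \<partial>\<mu>) \<le> 1"
        using exp_le int_exp by (subst nn_integral_eq_integral[symmetric]) auto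
      then show ?thesis using int_exp by (simp add: \<mu>.prob_space)
    qed
    finally show ?thesis using int_g int_h by (simp add: ent \<mu>.prob_space)
  qed
qed


section \<open>Coordinatewise Lipschitz functions\<close>

definition coord_lipschitz ::
  "'v set \<Rightarrow> ('v \<Rightarrow> real) \<Rightarrow> (('v \<Rightarrow> 'a::metric_space) \<Rightarrow> real) \<Rightarrow> bool" where
  "coord_lipschitz V c F \<longleftrightarrow>
     (\<forall>x\<in>V \<rightarrow>\<^sub>E UNIV. \<forall>y\<in>V \<rightarrow>\<^sub>E UNIV. \<bar>F x - F y\<bar> \<le> (\<Sum>v\<in>V. c v * dist (x v) (y v)))"

lemma coord_lipschitzD:
  "coord_lipschitz V c F \<Longrightarrow> x \<in> V \<rightarrow>\<^sub>E UNIV \<Longrightarrow> y \<in> V \<rightarrow>\<^sub>E UNIV \<Longrightarrow>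
    \<bar>F x - F y\<bar> \<le> (\<Sum>v\<in>V. c v * dist (x v) (y v))"
  unfolding coord_lipschitz_def by blast

lemma config_space_simple_approx:
  fixes V :: "'v set"
  assumes V: "finite V"
  obtains \<Phi> :: "nat \<Rightarrow> ('v \<Rightarrow> 'a::polish_space) \<Rightarrow> 'v \<Rightarrow> 'a"
  where "\<And>n. simple_function (config_space V) (\<Phi> n)"
    and "\<And>n x. \<Phi> n x \<in> V \<rightarrow>\<^sub>E UNIV"
    and "\<And>x v. v \<in> V \<Longrightarrow> (\<lambda>n. dist (x v) (\<Phi> n x v)) \<longlonglongrightarrow> 0"
proof -
  obtain F :: "nat \<Rightarrow> 'a \<Rightarrow> 'a" where F: "\<And>i. simple_function borel (F i)"
    and lim: "\<And>x. (\<lambda>i. F i x) \<longlonglongrightarrow> x"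
    using borel_measurable_implies_sequence_metric[of "\<lambda>x::'a. x" borel undefined] by auto
  define \<Phi> where "\<Phi> n x = (\<lambda>v\<in>V. F n (x v))" for n x
  show thesis
  proof
    show "simple_function (config_space V) (\<Phi> n)" for n
      unfolding simple_function_def
    proof (intro conjI ballI)
      have "\<Phi> n ` space (config_space V) \<subseteq> V \<rightarrow>\<^sub>E range (F n)"
        by (auto simp: \<Phi>_def)
      moreover have "finite (V \<rightarrow>\<^sub>E range (F n))"
        using F[of n] V by (intro finite_PiE) (auto simp: simple_function_def)
      ultimately show "finite (\<Phi> n ` space (config_space V))" by (rule finite_subset)
      fix w assume "w \<in> \<Phi> n ` space (config_space V)"
      then have w: "w \<in> extensional V" by (auto simp: \<Phi>_def)
      have "\<Phi> n -` {w} \<inter> space (config_space V)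
          = {x \<in> space (config_space V). \<forall>v\<in>V. F n (x v) = w v}"
        using w by (auto simp: \<Phi>_def fun_eq_iff restrict_def extensional_def)
      also have "\<dots> \<in> sets (config_space V)"
      proof (rule sets.sets_Collect_finite_All[OF _ V])
        fix v assume v: "v \<in> V"
        have "(\<lambda>x. F n (x v)) \<in> config_space V \<rightarrow>\<^sub>M count_space UNIV"
          by (rule measurable_compose[OF measurable_component_singleton[OF v]
            measurable_simple_function[OF F]])
        from measurable_sets[OF this, of "{w v}"]
        show "{x \<in> space (config_space V). F n (x v) = w v} \<in> sets (config_space V)"
          by (simp add: vimage_def Int_def conj_commute)
      qed
      finally show "\<Phi> n -` {w} \<inter> space (config_space V) \<in> sets (config_space V)" .
    qed
    show "\<Phi> n x \<in> V \<rightarrow>\<^sub>E UNIV" for n x by (auto simp: \<Phi>_def)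
    show "(\<lambda>n. dist (x v) (\<Phi> n x v)) \<longlonglongrightarrow> 0" if "v \<in> V" for x v
      using tendsto_dist[OF tendsto_const[of "x v"] lim[of "x v"]] that by (simp add: \<Phi>_def)
  qed
qed

lemma coord_lipschitz_measurable:
  fixes F :: "('v \<Rightarrow> 'a::polish_space) \<Rightarrow> real"
  assumes V: "finite V" and F: "coord_lipschitz V c F"
  shows "F \<in> borel_measurable (config_space V)"
proof (rule config_space_simple_approx[OF V])
  fix \<Phi> :: "nat \<Rightarrow> ('v \<Rightarrow> 'a) \<Rightarrow> 'v \<Rightarrow> 'a"
  assume \<Phi>: "\<And>n. simple_function (config_space V) (\<Phi> n)" "\<And>n x. \<Phi> n x \<in> V \<rightarrow>\<^sub>E UNIV"
    "\<And>x v. v \<in> V \<Longrightarrow> (\<lambda>n. dist (x v) (\<Phi> n x v)) \<longlonglongrightarrow> 0"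
  show ?thesis
  proof (rule measurable_lipschitz_approx[where c="\<lambda>x y. \<Sum>v\<in>V. c v * dist (x v) (y v)"])
    show "(\<lambda>n. \<Sum>v\<in>V. c v * dist (x v) (\<Phi> n x v)) \<longlonglongrightarrow> 0" for x
      by (rule tendsto_null_sum) (simp add: tendsto_mult_right_zero \<Phi>)
  qed (use F \<Phi> in \<open>auto simp: coord_lipschitz_def space_PiM\<close>)
qed

lemma coord_lipschitz_bounded:
  fixes F :: "('v \<Rightarrow> 'a::metric_space) \<Rightarrow> real"
  assumes diam: "\<And>x y :: 'a. dist x y \<le> 1" and V: "finite V"
    and F: "coord_lipschitz V c F" and c: "\<And>v. v \<in> V \<Longrightarrow> 0 \<le> c v"
  obtains B where "\<And>x. x \<in> V \<rightarrow>\<^sub>E UNIV \<Longrightarrow> \<bar>F x\<bar> \<le> B"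
proof
  fix x :: "'v \<Rightarrow> 'a" assume x: "x \<in> V \<rightarrow>\<^sub>E UNIV"
  define x0 :: "'v \<Rightarrow> 'a" where "x0 = (\<lambda>_. undefined)"
  have "x0 \<in> V \<rightarrow>\<^sub>E UNIV" by (simp add: x0_def PiE_def extensional_def)
  then have "\<bar>F x - F x0\<bar> \<le> (\<Sum>v\<in>V. c v * dist (x v) (x0 v))"
    using F x by (simp add: coord_lipschitz_def)
  also have "\<dots> \<le> (\<Sum>v\<in>V. c v)"
    using c diam by (intro sum_mono mult_left_le) auto
  finally show "\<bar>F x\<bar> \<le> \<bar>F (\<lambda>_. undefined)\<bar> + (\<Sum>v\<in>V. c v)" by (simp add: x0_def)
qed

section \<open>Integrals against nearby measures and Hoeffding's lemma\<close>

text \<open>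
  The easy direction of Kantorovich duality, for a pair of functions: every coupling bounds the
  difference of the integrals. The offset \<open>A\<close> absorbs the change of the other coordinates when \<open>g\<close>
  and \<open>h\<close> are sections of one function on a product space.
\<close>

lemma transport_dist_integral_diff:
  fixes g h :: "'a::polish_space \<Rightarrow> real"
  assumes P: "prob_space \<alpha>" "prob_space \<beta>" and sets_borel: "sets \<alpha> = sets borel" "sets \<beta> = sets borel"
    and int: "integrable \<alpha> g" "integrable \<beta> h"
    and lip: "\<And>z z'. \<bar>g z - h z'\<bar> \<le> A + L * dist z z'"
    and L: "0 \<le> L" and T: "transport_dist dist \<alpha> \<beta> \<le> ennreal T" "0 \<le> T"
  shows "\<bar>(\<integral>z. g z \<partial>\<alpha>) - (\<integral>z. h z \<partial>\<beta>)\<bar> \<le> A + L * T"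
proof -
  have *: "\<bar>(\<integral>z. g z \<partial>\<alpha>) - (\<integral>z. h z \<partial>\<beta>)\<bar> \<le> A + L * (T + e)" if e: "0 < e" for e
  proof -
    have "transport_dist dist \<alpha> \<beta> < ennreal (T + e)"
      using T e by (intro order.strict_trans1[OF T(1)]) (simp add: ennreal_less_iff)
    then obtain \<gamma> where \<gamma>: "\<gamma> \<in> couplings \<alpha> \<beta>"
      and cost: "(\<integral>\<^sup>+(x, y). ennreal (dist x y) \<partial>\<gamma>) < ennreal (T + e)"
      unfolding transport_dist_def INF_less_iff by blast
    have sets_\<gamma> [measurable_cong]: "sets \<gamma> = sets (borel \<Otimes>\<^sub>M borel)"
      using \<gamma> sets_borel by (simp add: couplings_def cong: sets_pair_measure_cong)
    have marg: "distr \<gamma> \<alpha> fst = \<alpha>" "distr \<gamma> \<beta> snd = \<beta>" using \<gamma> by (auto simp: couplings_def)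
    have meas: "fst \<in> \<gamma> \<rightarrow>\<^sub>M \<alpha>" "snd \<in> \<gamma> \<rightarrow>\<^sub>M \<beta>"
      using sets_borel by (simp_all cong: measurable_cong_sets add: measurable_cong_sets[OF sets_\<gamma>])
    interpret prob_space \<gamma>
      using P(1) marg(1) meas(1) by (metis prob_space_distrD)
    have int_g: "integrable \<gamma> (\<lambda>z. g (fst z))" "(\<integral>z. g z \<partial>\<alpha>) = (\<integral>z. g (fst z) \<partial>\<gamma>)"
      using integrable_distr_eq[OF meas(1), of g] integral_distr[OF meas(1), of g] int marg(1) by auto
    have int_h: "integrable \<gamma> (\<lambda>z. h (snd z))" "(\<integral>z. h z \<partial>\<beta>) = (\<integral>z. h (snd z) \<partial>\<gamma>)"
      using integrable_distr_eq[OF meas(2), of h] integral_distr[OF meas(2), of h] int marg(2) by auto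
    have cost': "(\<integral>\<^sup>+z. ennreal (dist (fst z) (snd z)) \<partial>\<gamma>) < ennreal (T + e)"
      using cost by (simp add: case_prod_unfold)
    have int_d: "integrable \<gamma> (\<lambda>z. dist (fst z) (snd z))"
      using cost' by (intro integrableI_nonneg) (auto intro: less_trans)
    have d_le: "(\<integral>z. dist (fst z) (snd z) \<partial>\<gamma>) \<le> T + e"
    proof -
      have "ennreal (\<integral>z. dist (fst z) (snd z) \<partial>\<gamma>) < ennreal (T + e)"
        using cost' nn_integral_eq_integral[OF int_d] by simp
      then show ?thesis by (subst (asm) ennreal_less_iff) simp_all
    qed
    have "\<bar>(\<integral>z. g z \<partial>\<alpha>) - (\<integral>z. h z \<partial>\<beta>)\<bar> = \<bar>\<integral>z. g (fst z) - h (snd z) \<partial>\<gamma>\<bar>"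
      using int_g int_h by simp
    also have "\<dots> \<le> (\<integral>z. \<bar>g (fst z) - h (snd z)\<bar> \<partial>\<gamma>)" by (rule integral_abs_bound)
    also have "\<dots> \<le> (\<integral>z. A + L * dist (fst z) (snd z) \<partial>\<gamma>)"
      using int_g int_h int_d lip by (intro integral_mono) auto
    also have "\<dots> = A + L * (\<integral>z. dist (fst z) (snd z) \<partial>\<gamma>)"
      using int_d by (simp add: prob_space)
    also have "\<dots> \<le> A + L * (T + e)"
      using d_le L by (simp add: mult_left_mono)
    finally show ?thesis .
  qed
  show ?thesis
  proof (rule field_le_epsilon)
    fix e :: real assume e: "0 < e"
    have "L * (e / (L + 1)) \<le> e" using L e by (simp add: field_simps)
    then show "\<bar>(\<integral>z. g z \<partial>\<alpha>) - (\<integral>z. h z \<partial>\<beta>)\<bar> \<le> A + L * T + e"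
      using *[of "e / (L + 1)"] L e by (simp add: distrib_left)
  qed
qed

text \<open>
  Hoeffding's lemma, with the range of \<open>g\<close> replaced by its oscillation.
\<close>

lemma (in prob_space) exp_moment_oscillation:
  fixes g :: "'a \<Rightarrow> real"
  assumes [measurable]: "g \<in> borel_measurable M"
    and osc: "\<And>x y. x \<in> space M \<Longrightarrow> y \<in> space M \<Longrightarrow> \<bar>g x - g y\<bar> \<le> c"
  shows "(\<integral>\<^sup>+x. ennreal (exp (g x)) \<partial>M) \<le> ennreal (exp ((\<integral>x. g x \<partial>M) + c\<^sup>2 / 8))"
proof -
  define a where "a = Inf (g ` space M)"
  define m where "m = (\<integral>x. g x \<partial>M)"
  obtain x0 where x0: "x0 \<in> space M" using not_empty by blast
  have low: "g x - c \<le> a" if "x \<in> space M" for x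
    unfolding a_def
  proof (rule cInf_greatest)
    show "g ` space M \<noteq> {}" using x0 by blast
    fix r assume "r \<in> g ` space M"
    then obtain y where "y \<in> space M" "r = g y" by blast
    then show "g x - c \<le> r" using osc[OF that, of y] by simp
  qed
  have "bdd_below (g ` space M)"
    using osc[OF x0] by (intro bdd_belowI[of _ "g x0 - c"]) fastforce
  then have up: "a \<le> g x" if "x \<in> space M" for x
    unfolding a_def using that by (intro cInf_lower) auto
  interpret interval_bounded_random_variable M "\<lambda>x. g x - m" "a - m" "a + c - m"
  proof unfold_locales
    show "AE x in M. g x - m \<in> {a - m..a + c - m}"
    proof (rule AE_I2)
      fix x assume "x \<in> space M"
      from low[OF this] up[OF this] show "g x - m \<in> {a - m..a + c - m}" by simp
    qed
  qed measurable
  have "integrable M g"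
    using Bochner_Integration.integrable_add[OF integrable integrable_const[of m]] by simp
  then have "expectation (\<lambda>x. g x - m) = 0" by (simp add: m_def prob_space)
  from Hoeffdings_lemma_nn_integral_0[OF zero_less_one this]
  have *: "(\<integral>\<^sup>+x. ennreal (exp (g x - m)) \<partial>M) \<le> ennreal (exp (c\<^sup>2 / 8))" by simp
  have "(\<integral>\<^sup>+x. ennreal (exp (g x)) \<partial>M) = (\<integral>\<^sup>+x. ennreal (exp m) * ennreal (exp (g x - m)) \<partial>M)"
    by (intro nn_integral_cong) (simp add: ennreal_mult'[symmetric] exp_add[symmetric])
  also have "\<dots> = ennreal (exp m) * (\<integral>\<^sup>+x. ennreal (exp (g x - m)) \<partial>M)"
    by (rule nn_integral_cmult) measurable
  also have "\<dots> \<le> ennreal (exp m) * ennreal (exp (c\<^sup>2 / 8))" by (rule mult_left_mono[OF *]) simp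
  finally show ?thesis by (simp add: ennreal_mult'[symmetric] exp_add m_def)
qed

section \<open>Sampling the coordinates one after another\<close>

text \<open>
  The law of coordinate \<open>v\<close> may depend on the whole configuration present when \<open>v\<close> is sampled. The
  measure \<open>run vs y\<close> below resamples the coordinates in the list \<open>vs\<close> in this order, starting from \<open>y\<close>.
\<close>

locale sequential_sampling =
  fixes V :: "'v set" and \<kappa> :: "'v \<Rightarrow> ('v \<Rightarrow> 'a::polish_space) \<Rightarrow> 'a measure"
  assumes V [simp]: "finite V"
    and kernel: "\<And>v. v \<in> V \<Longrightarrow> \<kappa> v \<in> config_space V \<rightarrow>\<^sub>M prob_algebra borel"
begin

abbreviation \<Omega> :: "('v \<Rightarrow> 'a) measure" where "\<Omega> \<equiv> config_space V"

primrec run :: "'v list \<Rightarrow> ('v \<Rightarrow> 'a) \<Rightarrow> ('v \<Rightarrow> 'a) measure" where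
  "run [] y = return \<Omega> y"
| "run (v # vs) y = distr (\<kappa> v y) \<Omega> (\<lambda>z. y(v := z)) \<bind> run vs"

lemma kernel_prob:
  assumes "v \<in> V" "y \<in> space \<Omega>"
  shows "prob_space (\<kappa> v y)" "sets (\<kappa> v y) = sets borel" "space (\<kappa> v y) = UNIV"
proof -
  have *: "sets (\<kappa> v y) = sets borel \<and> prob_space (\<kappa> v y)"
    using measurable_space[OF kernel[OF assms(1)] assms(2)] by (simp add: space_prob_algebra)
  then show "prob_space (\<kappa> v y)" "sets (\<kappa> v y) = sets borel" by simp_all
  from sets_eq_imp_space_eq[OF conjunct1[OF *]] show "space (\<kappa> v y) = UNIV" by simp
qed

lemma measurable_update_pair [measurable]:
  assumes "v \<in> V"
  shows "(\<lambda>(y, z). y(v := z)) \<in> \<Omega> \<Otimes>\<^sub>M borel \<rightarrow>\<^sub>M \<Omega>"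
  unfolding case_prod_unfold using assms by (intro measurable_fun_upd[of V V v]) auto

lemma measurable_update:
  assumes "v \<in> V" "y \<in> space \<Omega>"
  shows "(\<lambda>z. y(v := z)) \<in> borel \<rightarrow>\<^sub>M \<Omega>"
  using assms by (intro measurable_fun_upd[of V V v]) auto

lemma update_in_space: "v \<in> V \<Longrightarrow> y \<in> space \<Omega> \<Longrightarrow> y(v := z) \<in> space \<Omega>"
  using measurable_space[OF measurable_update] by simp

lemma update_kernel:
  assumes "v \<in> V"
  shows "(\<lambda>y. distr (\<kappa> v y) \<Omega> (\<lambda>z. y(v := z))) \<in> \<Omega> \<rightarrow>\<^sub>M prob_algebra \<Omega>"
  using kernel[OF assms] measurable_update_pair[OF assms] by (rule measurable_distr_prob_space2)

lemma run_kernel: "set vs \<subseteq> V \<Longrightarrow> run vs \<in> \<Omega> \<rightarrow>\<^sub>M prob_algebra \<Omega>"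
proof (induction vs)
  case Nil
  have "run [] = return \<Omega>" by (simp add: fun_eq_iff)
  then show ?case by simp
next
  case (Cons v vs)
  then have [measurable]: "run vs \<in> \<Omega> \<rightarrow>\<^sub>M prob_algebra \<Omega>" by simp
  have "(\<lambda>y. distr (\<kappa> v y) \<Omega> (\<lambda>z. y(v := z)) \<bind> run vs) \<in> \<Omega> \<rightarrow>\<^sub>M prob_algebra \<Omega>"
    using Cons.prems by (intro measurable_bind_prob_space2[OF update_kernel]) auto
  moreover have "run (v # vs) = (\<lambda>y. distr (\<kappa> v y) \<Omega> (\<lambda>z. y(v := z)) \<bind> run vs)"
    by (simp add: fun_eq_iff)
  ultimately show ?case by simp
qed

lemma run_prob:
  assumes "set vs \<subseteq> V" "y \<in> space \<Omega>"
  shows "prob_space (run vs y)" "sets (run vs y) = sets \<Omega>" "space (run vs y) = space \<Omega>"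
proof -
  have *: "sets (run vs y) = sets \<Omega> \<and> prob_space (run vs y)"
    using measurable_space[OF run_kernel[OF assms(1)] assms(2)] by (simp add: space_prob_algebra)
  then show "prob_space (run vs y)" "sets (run vs y) = sets \<Omega>" by simp_all
  from sets_eq_imp_space_eq[OF conjunct1[OF *]] show "space (run vs y) = space \<Omega>" .
qed

lemma run_Cons:
  assumes "set (v # vs) \<subseteq> V" "y \<in> space \<Omega>"
  shows "run (v # vs) y = \<kappa> v y \<bind> (\<lambda>z. run vs (y(v := z)))"
proof -
  have "(\<lambda>z. y(v := z)) \<in> \<kappa> v y \<rightarrow>\<^sub>M \<Omega>"
    using assms measurable_update[of v y] by (simp add: measurable_cong_sets[OF kernel_prob(2) HOL.refl])
  then show ?thesis
    using assms kernel_prob(3)[of v y]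
    by (simp add: bind_distr[OF _ measurable_prob_algebraD[OF run_kernel]])
qed

lemma nn_integral_run_Cons:
  assumes vs: "set (v # vs) \<subseteq> V" "y \<in> space \<Omega>" and F [measurable]: "F \<in> borel_measurable \<Omega>"
  shows "(\<integral>\<^sup>+x. F x \<partial>run (v # vs) y) = (\<integral>\<^sup>+z. \<integral>\<^sup>+x. F x \<partial>run vs (y(v := z)) \<partial>\<kappa> v y)"
proof -
  have "(\<lambda>z. run vs (y(v := z))) \<in> borel \<rightarrow>\<^sub>M prob_algebra \<Omega>"
    using vs by (intro measurable_compose[OF measurable_update run_kernel]) auto
  then have "(\<lambda>z. run vs (y(v := z))) \<in> \<kappa> v y \<rightarrow>\<^sub>M subprob_algebra \<Omega>"
    using vs by (intro measurable_prob_algebraD) (simp add: measurable_cong_sets[OF kernel_prob(2) HOL.refl])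
  then show ?thesis
    unfolding run_Cons[OF vs] by (rule nn_integral_bind[OF F])
qed

lemma run_append:
  assumes "set us \<subseteq> V" "set vs \<subseteq> V" "y \<in> space \<Omega>"
  shows "run (us @ vs) y = run us y \<bind> run vs"
  using assms
proof (induction us arbitrary: y)
  case Nil
  then show ?case using bind_return[OF measurable_prob_algebraD[OF run_kernel]] by simp
next
  case (Cons u us)
  have "distr (\<kappa> u y) \<Omega> (\<lambda>z. y(u := z)) \<bind> run (us @ vs)
      = distr (\<kappa> u y) \<Omega> (\<lambda>z. y(u := z)) \<bind> (\<lambda>x. run us x \<bind> run vs)"
    using Cons by (intro bind_cong) auto
  also have "\<dots> = distr (\<kappa> u y) \<Omega> (\<lambda>z. y(u := z)) \<bind> run us \<bind> run vs"
  proof (rule bind_assoc[symmetric])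
    show "run us \<in> distr (\<kappa> u y) \<Omega> (\<lambda>z. y(u := z)) \<rightarrow>\<^sub>M subprob_algebra \<Omega>"
      using measurable_prob_algebraD[OF run_kernel[of us]] Cons.prems by simp
    show "run vs \<in> \<Omega> \<rightarrow>\<^sub>M subprob_algebra \<Omega>"
      using measurable_prob_algebraD[OF run_kernel[of vs]] Cons.prems by simp
  qed
  finally show ?case by simp
qed

lemma nn_integral_run_append:
  assumes "set us \<subseteq> V" "set vs \<subseteq> V" "y \<in> space \<Omega>" and F: "F \<in> borel_measurable \<Omega>"
  shows "(\<integral>\<^sup>+x. F x \<partial>run (us @ vs) y) = (\<integral>\<^sup>+x. \<integral>\<^sup>+x'. F x' \<partial>run vs x \<partial>run us y)"
proof -
  have "run vs \<in> run us y \<rightarrow>\<^sub>M subprob_algebra \<Omega>"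
    using measurable_prob_algebraD[OF run_kernel[OF assms(2)]]
    by (simp add: measurable_cong_sets[OF run_prob(2)[OF assms(1,3)] HOL.refl])
  then show ?thesis
    unfolding run_append[OF assms(1-3)] by (rule nn_integral_bind[OF F])
qed

lemma nn_integral_run_snoc:
  assumes vs: "set vs \<subseteq> V" "v \<in> V" "y \<in> space \<Omega>" and F: "F \<in> borel_measurable \<Omega>"
  shows "(\<integral>\<^sup>+x. F x \<partial>run (vs @ [v]) y) = (\<integral>\<^sup>+x. \<integral>\<^sup>+z. F (x(v := z)) \<partial>\<kappa> v x \<partial>run vs y)"
proof -
  have "(\<integral>\<^sup>+x'. F x' \<partial>run [v] x) = (\<integral>\<^sup>+z. F (x(v := z)) \<partial>\<kappa> v x)" if "x \<in> space \<Omega>" for x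
    using nn_integral_run_Cons[of v "[]" x F] vs F that
    by (simp add: nn_integral_return update_in_space del: run.simps(2))
  then show ?thesis
    using vs F by (subst nn_integral_run_append)
      (auto intro!: nn_integral_cong simp: run_prob(3) simp del: run.simps(2))
qed

end


context sequential_sampling
begin

text \<open>
  Averaging out one coordinate. Removing the last sampled coordinate of a run in this way is what
  makes an induction over the list of coordinates possible.
\<close>

definition mean :: "'v \<Rightarrow> (('v \<Rightarrow> 'a) \<Rightarrow> real) \<Rightarrow> ('v \<Rightarrow> 'a) \<Rightarrow> real" where
  "mean v F x = (\<integral>z. F (x(v := z)) \<partial>\<kappa> v x)"

lemma integrable_kernel:
  fixes F :: "('v \<Rightarrow> 'a) \<Rightarrow> real"
  assumes "v \<in> V" "x \<in> space \<Omega>" and F: "F \<in> borel_measurable \<Omega>"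
    and B: "\<And>x. x \<in> space \<Omega> \<Longrightarrow> \<bar>F x\<bar> \<le> B"
  shows "integrable (\<kappa> v x) (\<lambda>z. F (x(v := z)))"
proof -
  interpret prob_space "\<kappa> v x" using assms by (intro kernel_prob)
  have "(\<lambda>z. F (x(v := z))) \<in> borel_measurable (\<kappa> v x)"
    using measurable_compose[OF measurable_update[OF assms(1,2)] F]
    by (simp add: measurable_cong_sets[OF kernel_prob(2)[OF assms(1,2)] HOL.refl])
  then show ?thesis
    using B[OF update_in_space[OF assms(1,2)]] by (intro integrable_const_bound[where B=B]) auto
qed

lemma integral_run_snoc:
  assumes vs: "set vs \<subseteq> V" "v \<in> V" "y \<in> space \<Omega>"
    and F: "F \<in> borel_measurable \<Omega>" and mean_F: "mean v F \<in> borel_measurable \<Omega>"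
    and B: "\<And>x. x \<in> space \<Omega> \<Longrightarrow> \<bar>F x\<bar> \<le> B"
  shows "(\<integral>x. F x \<partial>run (vs @ [v]) y) = (\<integral>x. mean v F x \<partial>run vs y)"
proof -
  have vsv: "set (vs @ [v]) \<subseteq> V" using vs by simp
  interpret R: prob_space "run vs y" using run_prob(1)[OF vs(1,3)] .
  interpret R': prob_space "run (vs @ [v]) y" using run_prob(1)[OF vsv vs(3)] .
  note [measurable_cong] = run_prob(2)[OF vs(1,3)] run_prob(2)[OF vsv vs(3)]
  note [simp] = run_prob(3)[OF vs(1,3)] run_prob(3)[OF vsv vs(3)]
  note [measurable] = F mean_F
  have mean_shift: "ennreal (mean v F x + B) = (\<integral>\<^sup>+z. ennreal (F (x(v := z)) + B) \<partial>\<kappa> v x)"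
    and mean_bound: "\<bar>mean v F x\<bar> \<le> B" if x: "x \<in> space \<Omega>" for x
  proof -
    interpret K: prob_space "\<kappa> v x" using vs x by (intro kernel_prob)
    have int: "integrable (\<kappa> v x) (\<lambda>z. F (x(v := z)))"
      using vs x F B by (intro integrable_kernel)
    have Bz: "\<bar>F (x(v := z))\<bar> \<le> B" for z
      using B[OF update_in_space[OF vs(2) x]] .
    have "(\<integral>\<^sup>+z. ennreal (F (x(v := z)) + B) \<partial>\<kappa> v x) = ennreal (\<integral>z. F (x(v := z)) + B \<partial>\<kappa> v x)"
    proof (intro nn_integral_eq_integral AE_I2)
      show "0 \<le> F (x(v := z)) + B" for z using Bz[of z] by linarith
    qed (use int in simp)
    also have "(\<integral>z. F (x(v := z)) + B \<partial>\<kappa> v x) = mean v F x + B"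
      using int by (simp add: mean_def K.prob_space)
    finally show "ennreal (mean v F x + B) = (\<integral>\<^sup>+z. ennreal (F (x(v := z)) + B) \<partial>\<kappa> v x)" by (rule sym)
    have "\<bar>mean v F x\<bar> \<le> (\<integral>z. \<bar>F (x(v := z))\<bar> \<partial>\<kappa> v x)"
      unfolding mean_def by (rule integral_abs_bound)
    also have "\<dots> \<le> (\<integral>z. B \<partial>\<kappa> v x)"
      using int Bz by (intro integral_mono) auto
    finally show "\<bar>mean v F x\<bar> \<le> B" by (simp add: K.prob_space)
  qed
  have int: "integrable (run (vs @ [v]) y) F" "integrable (run vs y) (mean v F)"
    using B mean_bound by (auto intro!: R.integrable_const_bound[of _ B] R'.integrable_const_bound[of _ B])
  have nonneg: "0 \<le> F x + B" "0 \<le> mean v F x + B" if "x \<in> space \<Omega>" for x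
    using B[OF that] mean_bound[OF that] by auto
  have "ennreal (\<integral>x. F x + B \<partial>run (vs @ [v]) y) = (\<integral>\<^sup>+x. ennreal (F x + B) \<partial>run (vs @ [v]) y)"
    using int nonneg by (intro nn_integral_eq_integral[symmetric]) auto
  also have "\<dots> = (\<integral>\<^sup>+x. ennreal (mean v F x + B) \<partial>run vs y)"
    using vs by (subst nn_integral_run_snoc) (auto intro!: nn_integral_cong simp: mean_shift)
  also have "\<dots> = ennreal (\<integral>x. mean v F x + B \<partial>run vs y)"
    using int nonneg by (intro nn_integral_eq_integral) auto
  finally have "(\<integral>x. F x + B \<partial>run (vs @ [v]) y) = (\<integral>x. mean v F x + B \<partial>run vs y)"
    using nonneg by (subst (asm) ennreal_inj) (auto intro!: Bochner_Integration.integral_nonneg)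
  then show ?thesis using int R.prob_space R'.prob_space by simp
qed

lemma measurable_override:
  assumes S: "S \<subseteq> V" and y: "y \<in> space \<Omega>" and M: "\<And>v. v \<in> S \<Longrightarrow> sets (M v) = sets borel"
  shows "(\<lambda>z. override_on y z S) \<in> Pi\<^sub>M S M \<rightarrow>\<^sub>M \<Omega>"
proof -
  have "(\<lambda>z. \<lambda>v\<in>V. if v \<in> S then z v else y v) \<in> Pi\<^sub>M S M \<rightarrow>\<^sub>M \<Omega>"
  proof (rule measurable_restrict)
    fix v assume "v \<in> V"
    show "(\<lambda>z. if v \<in> S then z v else y v) \<in> Pi\<^sub>M S M \<rightarrow>\<^sub>M borel"
    proof (cases "v \<in> S")
      case True
      then show ?thesis
        using measurable_component_singleton[of v S M]
        by (simp add: measurable_cong_sets[OF HOL.refl M])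
    qed simp
  qed
  moreover have "(\<lambda>v\<in>V. if v \<in> S then z v else y v) = override_on y z S" for z
    using S y by (auto simp: fun_eq_iff override_on_def space_PiM PiE_def extensional_def)
  ultimately show ?thesis by simp
qed

text \<open>
  Coordinates whose laws do not depend on each other can be sampled one by one or all at once. This
  identifies the layers of a Markov measure with segments of a run.
\<close>

lemma nn_integral_run_PiM:
  assumes "distinct vs" "set vs \<subseteq> V" "y \<in> space \<Omega>"
    and indep: "\<And>v w x z. v \<in> set vs \<Longrightarrow> w \<in> set vs \<Longrightarrow> \<kappa> w (x(v := z)) = \<kappa> w x"
    and G: "G \<in> borel_measurable \<Omega>"
  shows "(\<integral>\<^sup>+x. G x \<partial>run vs y) = (\<integral>\<^sup>+z. G (override_on y z (set vs)) \<partial>Pi\<^sub>M (set vs) (\<lambda>v. \<kappa> v y))"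
  using assms(1-4)
proof (induction vs arbitrary: y)
  case Nil
  then show ?case using G by (simp add: nn_integral_return PiM_empty nn_integral_count_space_finite)
next
  case (Cons v vs)
  define M where "M w = (if w \<in> set (v # vs) then \<kappa> w y else return borel undefined)" for w
  have M_prob: "prob_space (M w)" "sets (M w) = sets borel" for w
    using Cons.prems kernel_prob[of w y] by (auto simp: M_def prob_space_return)
  interpret product_sigma_finite M
    by (simp add: product_sigma_finite_def M_prob prob_space_imp_sigma_finite)
  have "(\<integral>\<^sup>+x. G x \<partial>run (v # vs) y) = (\<integral>\<^sup>+z. \<integral>\<^sup>+x. G x \<partial>run vs (y(v := z)) \<partial>\<kappa> v y)"
    using Cons.prems G by (intro nn_integral_run_Cons) auto
  also have "\<dots> = (\<integral>\<^sup>+z. \<integral>\<^sup>+x. G (override_on (y(v := z)) x (set vs)) \<partial>Pi\<^sub>M (set vs) M \<partial>M v)"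
  proof -
    have "(\<integral>\<^sup>+x. G x \<partial>run vs (y(v := z)))
        = (\<integral>\<^sup>+x. G (override_on (y(v := z)) x (set vs)) \<partial>Pi\<^sub>M (set vs) (\<lambda>w. \<kappa> w (y(v := z))))" for z
    proof (rule Cons.IH)
      show "y(v := z) \<in> space \<Omega>" using Cons.prems by (intro update_in_space) simp_all
    next
      show "\<kappa> w (x(u := z')) = \<kappa> w x" if "u \<in> set vs" "w \<in> set vs" for u w x z'
        using that by (intro Cons.prems(4)) simp_all
    qed (use Cons.prems in simp_all)
    moreover have "Pi\<^sub>M (set vs) (\<lambda>w. \<kappa> w (y(v := z))) = Pi\<^sub>M (set vs) M" for z
    proof (rule PiM_cong)
      fix w assume w: "w \<in> set vs"
      then have "\<kappa> w (y(v := z)) = \<kappa> w y" by (intro Cons.prems(4)) simp_all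
      with w show "\<kappa> w (y(v := z)) = M w" by (simp add: M_def)
    qed simp
    ultimately show ?thesis by (simp add: M_def)
  qed
  also have "\<dots> = (\<integral>\<^sup>+z. \<integral>\<^sup>+x. G (override_on y (x(v := z)) (set (v # vs))) \<partial>Pi\<^sub>M (set vs) M \<partial>M v)"
  proof -
    have "override_on (y(v := z)) x (set vs) = override_on y (x(v := z)) (set (v # vs))" for x z
      using Cons.prems(1) by (auto simp: override_on_def fun_eq_iff)
    then show ?thesis by simp
  qed
  also have "\<dots> = (\<integral>\<^sup>+z. G (override_on y z (set (v # vs))) \<partial>Pi\<^sub>M (insert v (set vs)) M)"
  proof (rule product_nn_integral_insert_rev[symmetric])
    show "(\<lambda>z. G (override_on y z (set (v # vs)))) \<in> borel_measurable (Pi\<^sub>M (insert v (set vs)) M)"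
      using measurable_compose[OF measurable_override[OF Cons.prems(2,3), of M] G] M_prob by simp
  qed (use Cons.prems in auto)
  also have "Pi\<^sub>M (insert v (set vs)) M = Pi\<^sub>M (set (v # vs)) (\<lambda>w. \<kappa> w y)"
    by (intro PiM_cong) (auto simp: M_def)
  finally show ?case .
qed

end

section \<open>Concentration from bounded influences\<close>

text \<open>
  The number \<open>a v u\<close> bounds how much the law of coordinate \<open>v\<close> moves, in transportation distance,
  when coordinate \<open>u\<close> of the present configuration moves.
\<close>

locale influence_sampling = sequential_sampling V \<kappa>
  for V :: "'v set" and \<kappa> :: "'v \<Rightarrow> ('v \<Rightarrow> 'a::polish_space) \<Rightarrow> 'a measure" +
  fixes a :: "'v \<Rightarrow> 'v \<Rightarrow> real"
  assumes diam: "\<And>x y :: 'a. dist x y \<le> 1"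
    and a_nonneg: "\<And>v u. 0 \<le> a v u"
    and influence: "\<And>v x y. v \<in> V \<Longrightarrow> x \<in> space \<Omega> \<Longrightarrow> y \<in> space \<Omega> \<Longrightarrow>
      transport_dist dist (\<kappa> v x) (\<kappa> v y) \<le> ennreal (\<Sum>u\<in>V. a v u * dist (x u) (y u))"
begin

text \<open>
  Averaging out \<open>v\<close> removes the direct dependence on coordinate \<open>v\<close> and passes the constant \<open>c v\<close>
  on to the coordinates that influence \<open>v\<close>.
\<close>

lemma mean_coord_lipschitz:
  assumes v: "v \<in> V" and F: "coord_lipschitz V c F" and c: "\<And>u. u \<in> V \<Longrightarrow> 0 \<le> c u"
  shows "coord_lipschitz V (\<lambda>u. (if u = v then 0 else c u) + c v * a v u) (mean v F)"
  unfolding coord_lipschitz_def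
proof (intro ballI)
  fix x y :: "'v \<Rightarrow> 'a" assume "x \<in> V \<rightarrow>\<^sub>E UNIV" "y \<in> V \<rightarrow>\<^sub>E UNIV"
  then have xy: "x \<in> space \<Omega>" "y \<in> space \<Omega>" by (simp_all add: space_PiM)
  obtain B where B: "\<And>x. x \<in> V \<rightarrow>\<^sub>E UNIV \<Longrightarrow> \<bar>F x\<bar> \<le> B"
    using coord_lipschitz_bounded[OF diam V F c] by blast
  have F_meas: "F \<in> borel_measurable \<Omega>" using F by (rule coord_lipschitz_measurable[OF V])
  have "\<bar>mean v F x - mean v F y\<bar>
      \<le> (\<Sum>u\<in>V - {v}. c u * dist (x u) (y u)) + c v * (\<Sum>u\<in>V. a v u * dist (x u) (y u))"
    unfolding mean_def
  proof (rule transport_dist_integral_diff)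
    fix z z'
    have "\<bar>F (x(v := z)) - F (y(v := z'))\<bar>
        \<le> (\<Sum>u\<in>V. c u * dist ((x(v := z)) u) ((y(v := z')) u))"
      using update_in_space[OF v xy(1), of z] update_in_space[OF v xy(2), of z']
      by (intro coord_lipschitzD[OF F]) (simp_all add: space_PiM)
    also have "\<dots> = c v * dist z z' + (\<Sum>u\<in>V - {v}. c u * dist (x u) (y u))"
      using v by (subst sum.remove[of V v]) (auto intro!: sum.cong)
    finally show "\<bar>F (x(v := z)) - F (y(v := z'))\<bar>
        \<le> (\<Sum>u\<in>V - {v}. c u * dist (x u) (y u)) + c v * dist z z'" by simp
  next
    show "integrable (\<kappa> v x) (\<lambda>z. F (x(v := z)))" "integrable (\<kappa> v y) (\<lambda>z. F (y(v := z)))"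
      using v xy F_meas B by (auto intro!: integrable_kernel[where B=B] simp: space_PiM)
  qed (use v xy c a_nonneg kernel_prob influence in \<open>auto intro!: sum_nonneg\<close>)
  also have "(\<Sum>u\<in>V - {v}. c u * dist (x u) (y u))
      = (\<Sum>u\<in>V. (if u = v then 0 else c u) * dist (x u) (y u))"
    using v by (subst sum.remove[of V v]) (auto intro!: sum.cong)
  also have "(\<Sum>u\<in>V. (if u = v then 0 else c u) * dist (x u) (y u)) + c v * (\<Sum>u\<in>V. a v u * dist (x u) (y u))
      = (\<Sum>u\<in>V. ((if u = v then 0 else c u) + c v * a v u) * dist (x u) (y u))"
    unfolding sum_distrib_left sum.distrib[symmetric] by (intro sum.cong) (auto simp: algebra_simps)
  finally show "\<bar>mean v F x - mean v F y\<bar>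
      \<le> (\<Sum>u\<in>V. ((if u = v then 0 else c u) + c v * a v u) * dist (x u) (y u))" .
qed

text \<open>
  Induction from the last sampled coordinate. Averaging it out costs a factor \<open>exp ((C v)\<^sup>2 / 8)\<close> by
  Hoeffding's lemma and turns the Lipschitz constants \<open>c\<close> into those of \<open>mean_coord_lipschitz\<close>.
  The inequality between \<open>c\<close> and \<open>C\<close> is preserved by this step, so that \<open>C v\<close> dominates the
  Lipschitz constant in coordinate \<open>v\<close> at the moment when \<open>v\<close> is averaged out.
\<close>

theorem exp_moment_run:
  assumes "set vs \<subseteq> V" "distinct vs" and y: "y \<in> space \<Omega>"
    and F: "coord_lipschitz V c F" and c: "\<And>u. u \<in> V \<Longrightarrow> 0 \<le> c u"
    and C: "\<And>u. u \<in> V \<Longrightarrow> 0 \<le> C u"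
    and rec: "\<And>u. u \<in> V \<Longrightarrow> c u + (\<Sum>w\<in>set vs. a w u * C w) \<le> C u"
  shows "(\<integral>\<^sup>+x. ennreal (exp (F x)) \<partial>run vs y)
    \<le> ennreal (exp ((\<integral>x. F x \<partial>run vs y) + (\<Sum>v\<in>set vs. (C v)\<^sup>2) / 8))"
  using assms(1,2,4,5,7)
proof (induction vs arbitrary: c F rule: rev_induct)
  case Nil
  have F_meas: "F \<in> borel_measurable \<Omega>" using Nil by (intro coord_lipschitz_measurable[OF V])
  have "(\<integral>x. F x \<partial>return \<Omega> y) = F y"
    using F_meas y by (intro integral_return) auto
  then show ?case using F_meas y by (simp add: nn_integral_return)
next
  case (snoc v vs)
  have vs: "set vs \<subseteq> V" "v \<in> V" "distinct vs" "v \<notin> set vs" using snoc.prems by auto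
  define c' where "c' u = (if u = v then 0 else c u) + c v * a v u" for u
  have F_meas [measurable]: "F \<in> borel_measurable \<Omega>"
    using snoc.prems(3) by (rule coord_lipschitz_measurable[OF V])
  have mean_lip: "coord_lipschitz V c' (mean v F)"
    unfolding c'_def using vs(2) snoc.prems(3,4) by (rule mean_coord_lipschitz)
  then have mean_meas [measurable]: "mean v F \<in> borel_measurable \<Omega>"
    by (rule coord_lipschitz_measurable[OF V])
  obtain B where B: "\<And>x. x \<in> V \<rightarrow>\<^sub>E UNIV \<Longrightarrow> \<bar>F x\<bar> \<le> B"
    using coord_lipschitz_bounded[OF diam V snoc.prems(3,4)] by blast
  have sum_nonneg: "0 \<le> (\<Sum>w\<in>S. a w u * C w)" if "S \<subseteq> V" for S u
    using that C a_nonneg by (intro sum_nonneg mult_nonneg_nonneg) auto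
  have c_le: "c v \<le> C v"
    using snoc.prems(5)[OF vs(2)] sum_nonneg[OF snoc.prems(1), of v] by linarith
  have IH: "(\<integral>\<^sup>+x. ennreal (exp (mean v F x)) \<partial>run vs y)
      \<le> ennreal (exp ((\<integral>x. mean v F x \<partial>run vs y) + (\<Sum>v\<in>set vs. (C v)\<^sup>2) / 8))"
  proof (rule snoc.IH[OF vs(1,3) mean_lip])
    fix u assume u: "u \<in> V"
    show "0 \<le> c' u" using snoc.prems(4) u vs(2) a_nonneg by (simp add: c'_def)
    have "c v * a v u \<le> a v u * C v"
      using c_le a_nonneg[of v u] by (simp add: mult.commute mult_right_mono)
    then have "c' u \<le> c u + a v u * C v" using snoc.prems(4)[OF u] by (cases "u = v") (simp_all add: c'_def)
    then show "c' u + (\<Sum>w\<in>set vs. a w u * C w) \<le> C u"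
      using snoc.prems(5)[OF u] vs(4) by simp
  qed
  have "(\<integral>\<^sup>+x. ennreal (exp (F x)) \<partial>run (vs @ [v]) y)
      = (\<integral>\<^sup>+x. \<integral>\<^sup>+z. ennreal (exp (F (x(v := z)))) \<partial>\<kappa> v x \<partial>run vs y)"
    using vs y by (intro nn_integral_run_snoc) measurable
  also have "\<dots> \<le> (\<integral>\<^sup>+x. ennreal (exp ((C v)\<^sup>2 / 8)) * ennreal (exp (mean v F x)) \<partial>run vs y)"
  proof (rule nn_integral_mono)
    fix x assume "x \<in> space (run vs y)"
    then have x: "x \<in> space \<Omega>" using run_prob(3)[OF vs(1) y] by simp
    interpret K: prob_space "\<kappa> v x" using vs x by (intro kernel_prob)
    have "(\<integral>\<^sup>+z. ennreal (exp (F (x(v := z)))) \<partial>\<kappa> v x)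
        \<le> ennreal (exp ((\<integral>z. F (x(v := z)) \<partial>\<kappa> v x) + (C v)\<^sup>2 / 8))"
    proof (rule K.exp_moment_oscillation)
      show "(\<lambda>z. F (x(v := z))) \<in> borel_measurable (\<kappa> v x)"
        using measurable_compose[OF measurable_update[OF vs(2) x] F_meas]
        by (simp add: measurable_cong_sets[OF kernel_prob(2)[OF vs(2) x] HOL.refl])
      have upd: "x(v := z) \<in> V \<rightarrow>\<^sub>E UNIV" for z
        using update_in_space[OF vs(2) x, of z] by (simp add: space_PiM)
      fix z z'
      have "\<bar>F (x(v := z)) - F (x(v := z'))\<bar>
          \<le> (\<Sum>u\<in>V. c u * dist ((x(v := z)) u) ((x(v := z')) u))"
        by (rule coord_lipschitzD[OF snoc.prems(3) upd upd])
      also have "\<dots> = c v * dist z z'"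
        using vs(2) by (subst sum.remove[of V v]) auto
      also have "\<dots> \<le> C v * 1"
        using c_le C[OF vs(2)] diam by (intro mult_mono) auto
      finally show "\<bar>F (x(v := z)) - F (x(v := z'))\<bar> \<le> C v" by simp
    qed
    then show "(\<integral>\<^sup>+z. ennreal (exp (F (x(v := z)))) \<partial>\<kappa> v x)
        \<le> ennreal (exp ((C v)\<^sup>2 / 8)) * ennreal (exp (mean v F x))"
      by (simp add: mean_def exp_add ennreal_mult'[symmetric] mult.commute)
  qed
  also have "\<dots> = ennreal (exp ((C v)\<^sup>2 / 8)) * (\<integral>\<^sup>+x. ennreal (exp (mean v F x)) \<partial>run vs y)"
    by (rule nn_integral_cmult) (simp add: measurable_cong_sets[OF run_prob(2)[OF vs(1) y] HOL.refl])
  also have "\<dots> \<le> ennreal (exp ((C v)\<^sup>2 / 8))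
      * ennreal (exp ((\<integral>x. mean v F x \<partial>run vs y) + (\<Sum>v\<in>set vs. (C v)\<^sup>2) / 8))"
    by (rule mult_left_mono[OF IH]) simp
  also have "(\<integral>x. mean v F x \<partial>run vs y) = (\<integral>x. F x \<partial>run (vs @ [v]) y)"
    using vs y F_meas mean_meas B by (intro integral_run_snoc[symmetric, where B=B]) (auto simp: space_PiM)
  finally show ?case
    using vs(4) by (simp add: ennreal_mult'[symmetric] exp_add[symmetric] add_divide_distrib algebra_simps)
qed

end


section \<open>Markov measures on trees\<close>

text \<open>
  The law of the root does not depend on the configuration, and the diagonal coupling shows that it
  has zero influence from every coordinate.
\<close>

lemma transport_dist_self:
  fixes \<mu> :: "'a::polish_space measure"
  assumes \<mu>: "prob_space \<mu>" "sets \<mu> = sets borel"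
  shows "transport_dist dist \<mu> \<mu> = 0"
proof -
  note \<mu>(2)[measurable_cong]
  define \<gamma> where "\<gamma> = distr \<mu> (\<mu> \<Otimes>\<^sub>M \<mu>) (\<lambda>x. (x, x))"
  have diag: "(\<lambda>x. (x, x)) \<in> \<mu> \<rightarrow>\<^sub>M \<mu> \<Otimes>\<^sub>M \<mu>" by measurable
  have "distr \<gamma> \<mu> fst = \<mu>" "distr \<gamma> \<mu> snd = \<mu>"
    unfolding \<gamma>_def by (simp_all add: distr_distr[OF _ diag] comp_def distr_id)
  then have "\<gamma> \<in> couplings \<mu> \<mu>" by (simp add: couplings_def \<gamma>_def)
  moreover have "(\<integral>\<^sup>+(x, y). ennreal (dist x y) \<partial>\<gamma>) = 0"
    unfolding \<gamma>_def by (subst nn_integral_distr[OF diag]) simp_all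
  ultimately have "transport_dist dist \<mu> \<mu> \<le> 0"
    unfolding transport_dist_def by (metis INF_lower)
  then show ?thesis by simp
qed

locale tree_markov = rooted_tree V E \<rho>
  for V :: "'v set" and E :: "'v set set" and \<rho> :: 'v +
  fixes \<nu>\<^sub>\<rho> :: "'a::polish_space measure" and q :: "'v \<Rightarrow> 'a \<Rightarrow> 'a measure"
    and \<nu> :: "('v \<Rightarrow> 'a) measure" and b :: real
  assumes diam: "\<And>x y :: 'a. dist x y \<le> 1"
    and b: "0 \<le> b"
    and markov: "markov_measure V E \<rho> \<nu>\<^sub>\<rho> q \<nu>"
    and lipschitz: "\<And>v. v \<in> V - {\<rho>} \<Longrightarrow> lipschitz_kernel b (q v)"
begin

definition kernel :: "'v \<Rightarrow> ('v \<Rightarrow> 'a) \<Rightarrow> 'a measure" where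
  "kernel v y = (if v = \<rho> then \<nu>\<^sub>\<rho> else q v (y (parent V E \<rho> v)))"

definition weight :: "'v \<Rightarrow> 'v \<Rightarrow> real" where
  "weight v u = (if v \<in> V - {\<rho>} \<and> u = parent V E \<rho> v then b else 0)"

lemma V_nonempty: "V \<noteq> {}"
  using root_in_V by blast

sublocale influence_sampling V kernel weight
proof
  show kernel: "kernel v \<in> config_space V \<rightarrow>\<^sub>M prob_algebra borel" if v: "v \<in> V" for v
  proof (cases "v = \<rho>")
    case True
    have "(\<lambda>_. \<nu>\<^sub>\<rho>) \<in> config_space V \<rightarrow>\<^sub>M prob_algebra borel"
      using markov by (intro measurable_const) (simp add: markov_measure_def)
    then show ?thesis using True by (simp add: kernel_def[abs_def])
  next
    case False
    then have q: "q v \<in> borel \<rightarrow>\<^sub>M prob_algebra borel" and "parent V E \<rho> v \<in> V"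
      using v markov parent_in_V by (auto simp: markov_measure_def)
    from this(2) have "(\<lambda>y. y (parent V E \<rho> v)) \<in> config_space V \<rightarrow>\<^sub>M borel"
      by (rule measurable_component_singleton)
    from measurable_compose[OF this q]
    have "(\<lambda>y. q v (y (parent V E \<rho> v))) \<in> config_space V \<rightarrow>\<^sub>M prob_algebra borel" .
    then show ?thesis using False by (simp add: kernel_def[abs_def])
  qed
  have kernel_prob': "prob_space (kernel v x)" "sets (kernel v x) = sets borel"
    if "v \<in> V" "x \<in> space (config_space V)" for v x
    using measurable_space[OF kernel[OF that(1)] that(2)] by (simp_all add: space_prob_algebra)
  show "0 \<le> weight v u" for v u using b by (simp add: weight_def)
  show "transport_dist dist (kernel v x) (kernel v y) \<le> ennreal (\<Sum>u\<in>V. weight v u * dist (x u) (y u))"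
    if v: "v \<in> V" and xy: "x \<in> space (config_space V)" "y \<in> space (config_space V)" for v x y
  proof (cases "v = \<rho>")
    case True
    then show ?thesis
      using transport_dist_self[OF kernel_prob'[OF v xy(1)]] by (simp add: kernel_def)
  next
    case False
    have "(\<Sum>u\<in>V. weight v u * dist (x u) (y u))
        = (\<Sum>u\<in>V. if u = parent V E \<rho> v then b * dist (x u) (y u) else 0)"
      using v False by (intro sum.cong) (auto simp: weight_def)
    also have "\<dots> = b * dist (x (parent V E \<rho> v)) (y (parent V E \<rho> v))"
      using parent_in_V[of v] v False by simp
    finally show ?thesis
      using lipschitz[of v] v False by (simp add: kernel_def lipschitz_kernel_def)
  qed
qed (use diam in simp_all)

text \<open>
  The order inside a layer is arbitrary; the concatenation puts every parent before its children.
\<close>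

lemma enumeration_by_depth:
  obtains L where "\<And>k. distinct (L k)" and "\<And>k. set (L k) = layer V E \<rho> k"
    and "\<And>m. distinct (concat (map L [0..<m]))"
    and "set (concat (map L [0..<Suc (tree_depth V E \<rho>)])) = V"
proof -
  obtain l where l: "set l = V" "distinct l" using finite_distinct_list[OF finite_V] by blast
  define L where "L k = filter (\<lambda>v. graph_dist V E \<rho> v = k) l" for k
  have set_L: "set (L k) = layer V E \<rho> k" for k by (auto simp: L_def layer_def l)
  have dist_L: "distinct (L k)" for k by (simp add: L_def l)
  have "distinct (concat (map L [0..<m]))" for m
    by (induction m) (auto simp: dist_L set_L layer_def)
  moreover have "set (concat (map L [0..<Suc (tree_depth V E \<rho>)])) = V"
  proof -
    have "graph_dist V E \<rho> v < Suc (tree_depth V E \<rho>)" if "v \<in> V" for v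
      using that by (simp add: tree_depth_def less_Suc_eq_le)
    then show ?thesis by (auto simp: set_L layer_def simp del: upt_Suc)
  qed
  ultimately show thesis using that dist_L set_L by blast
qed

text \<open>
  The laws of the vertices in one layer depend on their parents only, which lie in the layer above;
  hence the integral over the layer is a run through its vertices in any order.
\<close>

lemma layer_integral_eq_run:
  assumes L: "\<And>k. distinct (L k)" "\<And>k. set (L k) = layer V E \<rho> k"
    and F: "F \<in> borel_measurable \<Omega>"
  shows "y \<in> space \<Omega> \<Longrightarrow>
    layer_integral V E \<rho> \<nu>\<^sub>\<rho> q m k F y = (\<integral>\<^sup>+x. F x \<partial>run (concat (map L [k..<k + m])) y)"
proof (induction m arbitrary: k y)
  case 0
  then show ?case using F by (simp add: nn_integral_return)
next
  case (Suc m)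
  let ?vs = "concat (map L [Suc k..<Suc k + m])"
  have LV: "set (L k) \<subseteq> V" for k by (auto simp: L(2) layer_def)
  have vs: "set ?vs \<subseteq> V" using LV by auto
  define G where "G x = (\<integral>\<^sup>+x'. F x' \<partial>run ?vs x)" for x
  have G: "G \<in> borel_measurable \<Omega>"
    unfolding G_def[abs_def]
    by (rule measurable_compose[OF measurable_prob_algebraD[OF run_kernel[OF vs]]
      nn_integral_measurable_subprob_algebra[OF F]])
  have "layer_integral V E \<rho> \<nu>\<^sub>\<rho> q (Suc m) k F y
      = (\<integral>\<^sup>+z. layer_integral V E \<rho> \<nu>\<^sub>\<rho> q m (Suc k) F (override_on y z (set (L k)))
          \<partial>Pi\<^sub>M (set (L k)) (\<lambda>v. kernel v y))"
    by (simp add: kernel_def L(2))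
  also have "\<dots> = (\<integral>\<^sup>+z. G (override_on y z (set (L k))) \<partial>Pi\<^sub>M (set (L k)) (\<lambda>v. kernel v y))"
  proof -
    have "override_on y z (set (L k)) \<in> space \<Omega>" for z
      using Suc.prems LV[of k] by (auto simp: space_PiM PiE_def extensional_def override_on_def)
    then show ?thesis by (simp add: Suc.IH G_def)
  qed
  also have "\<dots> = (\<integral>\<^sup>+x. G x \<partial>run (L k) y)"
  proof (rule nn_integral_run_PiM[symmetric, OF L(1) LV Suc.prems _ G])
    fix v w :: 'v and x :: "'v \<Rightarrow> 'a" and z assume "v \<in> set (L k)" "w \<in> set (L k)"
    then have "w = \<rho> \<or> parent V E \<rho> w \<noteq> v"
      using root_dist_parent[of w] by (auto simp: L(2) layer_def)
    then show "kernel w (x(v := z)) = kernel w x" by (auto simp: kernel_def)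
  qed
  also have "\<dots> = (\<integral>\<^sup>+x. F x \<partial>run (L k @ ?vs) y)"
    unfolding G_def by (rule nn_integral_run_append[OF LV vs Suc.prems F, symmetric])
  also have "L k @ ?vs = concat (map L [k..<k + Suc m])"
    by (simp add: upt_conv_Cons del: upt_Suc)
  finally show ?case .
qed

lemma markov_measure_eq_run:
  obtains vs where "distinct vs" "set vs = V" "\<nu> = run vs (\<lambda>_. undefined)"
proof -
  obtain L where L: "\<And>k. distinct (L k)" "\<And>k. set (L k) = layer V E \<rho> k"
    and dist: "\<And>m. distinct (concat (map L [0..<m]))"
    and set_V: "set (concat (map L [0..<Suc (tree_depth V E \<rho>)])) = V"
    using enumeration_by_depth by blast
  define vs where "vs = concat (map L [0..<Suc (tree_depth V E \<rho>)])"
  have vs: "set vs = V" "distinct vs" using dist set_V by (simp_all add: vs_def del: upt_Suc)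
  have u: "(\<lambda>_. undefined) \<in> space \<Omega>" by (simp add: space_PiM PiE_def extensional_def)
  have sets_run: "sets (run vs (\<lambda>_. undefined)) = sets \<Omega>" using run_prob(2)[OF _ u] vs by simp
  have "\<nu> = run vs (\<lambda>_. undefined)"
  proof (rule measure_eqI)
    show "sets \<nu> = sets (run vs (\<lambda>_. undefined))"
      using markov sets_run by (simp add: markov_measure_def space_prob_algebra)
    fix A assume "A \<in> sets \<nu>"
    then have A: "A \<in> sets \<Omega>" using markov by (simp add: markov_measure_def space_prob_algebra)
    have "emeasure \<nu> A
        = layer_integral V E \<rho> \<nu>\<^sub>\<rho> q (Suc (tree_depth V E \<rho>)) 0 (indicator A) (\<lambda>_. undefined)"
      using markov A unfolding markov_measure_def by blast
    also have "\<dots> = (\<integral>\<^sup>+x. indicator A x \<partial>run vs (\<lambda>_. undefined))"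
      using layer_integral_eq_run[OF L _ u, of "indicator A" "Suc (tree_depth V E \<rho>)" 0] A
      by (simp add: vs_def del: upt_Suc layer_integral.simps)
    also have "\<dots> = emeasure (run vs (\<lambda>_. undefined)) A" using A sets_run by simp
    finally show "emeasure \<nu> A = emeasure (run vs (\<lambda>_. undefined)) A" .
  qed
  then show thesis using that vs by blast
qed

lemma prob_\<nu>: "prob_space \<nu>" and sets_\<nu>: "sets \<nu> = sets \<Omega>"
  using markov by (simp_all add: markov_measure_def space_prob_algebra)

text \<open>
  The function \<open>n * t * f\<close> has Lipschitz constant \<open>\<bar>t\<bar>\<close> in every coordinate, and the recursion for
  \<open>\<delta>\<close> says that \<open>C v = \<bar>t\<bar> * \<delta>(v)\<close> is admissible in \<open>exp_moment_run\<close>.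
\<close>

theorem exp_moment_hamming_lipschitz:
  assumes f: "\<And>x y. x \<in> V \<rightarrow>\<^sub>E UNIV \<Longrightarrow> y \<in> V \<rightarrow>\<^sub>E UNIV \<Longrightarrow> \<bar>f x - f y\<bar> \<le> hamming V x y"
    and mean_0: "(\<integral>x. f x \<partial>\<nu>) = 0"
  shows "(\<integral>\<^sup>+x. ennreal (exp (real (card V) * t * f x)) \<partial>\<nu>)
    \<le> ennreal (exp (t\<^sup>2 * (desc_gen_norm V E \<rho> b)\<^sup>2 / 8))"
proof -
  let ?\<delta> = "desc_gen_fun V E \<rho> b"
  define F where "F x = real (card V) * t * f x" for x
  obtain vs where vs: "distinct vs" "set vs = V" "\<nu> = run vs (\<lambda>_. undefined)"
    by (rule markov_measure_eq_run)
  have F_lip: "coord_lipschitz V (\<lambda>_. \<bar>t\<bar>) F"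
    unfolding coord_lipschitz_def
  proof (intro ballI)
    fix x y :: "'v \<Rightarrow> 'a" assume xy: "x \<in> V \<rightarrow>\<^sub>E UNIV" "y \<in> V \<rightarrow>\<^sub>E UNIV"
    have "\<bar>F x - F y\<bar> = real (card V) * \<bar>t\<bar> * \<bar>f x - f y\<bar>"
      by (simp add: F_def right_diff_distrib[symmetric] abs_mult)
    also have "\<dots> \<le> real (card V) * \<bar>t\<bar> * hamming V x y"
      using f[OF xy] by (intro mult_left_mono) auto
    also have "\<dots> = (\<Sum>v\<in>V. \<bar>t\<bar> * dist (x v) (y v))"
      using card_V_pos V_nonempty by (simp add: hamming_def sum_distrib_left)
    finally show "\<bar>F x - F y\<bar> \<le> (\<Sum>v\<in>V. \<bar>t\<bar> * dist (x v) (y v))" .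
  qed
  have "(\<integral>\<^sup>+x. ennreal (exp (F x)) \<partial>\<nu>)
      \<le> ennreal (exp ((\<integral>x. F x \<partial>\<nu>) + (\<Sum>v\<in>set vs. (\<bar>t\<bar> * ?\<delta> v)\<^sup>2) / 8))"
    unfolding vs(3)
  proof (rule exp_moment_run[OF _ vs(1) _ F_lip])
    fix u assume u: "u \<in> V"
    show "0 \<le> \<bar>t\<bar> * ?\<delta> u" using desc_gen_fun_ge_1[OF u b] by simp
    have "(\<Sum>w\<in>set vs. weight w u * (\<bar>t\<bar> * ?\<delta> w))
        = (\<Sum>w\<in>V. if w \<in> children u then b * (\<bar>t\<bar> * ?\<delta> w) else 0)"
      unfolding vs(2) by (intro sum.cong) (auto simp: weight_def children_def)
    also have "\<dots> = (\<Sum>w\<in>children u. b * (\<bar>t\<bar> * ?\<delta> w))"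
    proof -
      have "V \<inter> children u = children u" by (auto simp: children_def)
      then show ?thesis using sum.inter_restrict[OF finite_V, of _ "children u"] by metis
    qed
    also have "\<dots> = \<bar>t\<bar> * (b * (\<Sum>w\<in>children u. ?\<delta> w))"
      by (simp add: sum_distrib_left mult_ac)
    finally have "\<bar>t\<bar> + (\<Sum>w\<in>set vs. weight w u * (\<bar>t\<bar> * ?\<delta> w))
        = \<bar>t\<bar> * (1 + b * (\<Sum>w\<in>children u. ?\<delta> w))"
      by (simp add: algebra_simps)
    also have "\<dots> \<le> \<bar>t\<bar> * ?\<delta> u"
      using desc_gen_fun_children[OF u b] by (intro mult_left_mono) auto
    finally show "\<bar>t\<bar> + (\<Sum>w\<in>set vs. weight w u * (\<bar>t\<bar> * ?\<delta> w)) \<le> \<bar>t\<bar> * ?\<delta> u" .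
  qed (use vs in \<open>auto simp: space_PiM PiE_def extensional_def\<close>)
  also have "(\<integral>x. F x \<partial>\<nu>) = 0" by (simp add: F_def mean_0)
  also have "(\<Sum>v\<in>set vs. (\<bar>t\<bar> * ?\<delta> v)\<^sup>2) = t\<^sup>2 * (desc_gen_norm V E \<rho> b)\<^sup>2"
    by (simp add: vs(2) desc_gen_norm_def sum_nonneg power_mult_distrib sum_distrib_left)
  finally show ?thesis by (simp add: F_def)
qed

lemma desc_gen_norm_pos: "0 < desc_gen_norm V E \<rho> b"
proof -
  have "0 < (desc_gen_fun V E \<rho> b \<rho>)\<^sup>2"
    using desc_gen_fun_ge_1[OF root_in_V b] by (intro zero_less_power) linarith
  then have "0 < (\<Sum>v\<in>V. (desc_gen_fun V E \<rho> b v)\<^sup>2)"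
    by (intro sum_pos2[OF finite_V root_in_V]) auto
  then show ?thesis by (simp add: desc_gen_norm_def)
qed

text \<open>
  The Gibbs variational inequality and the exponential moment bound give
  \<open>n * t * d \<le> D + t\<^sup>2 * \<Delta>\<^sup>2 / 8\<close> for every \<open>t\<close>, where \<open>d\<close> is the difference of the
  means; the claim is the best choice of \<open>t\<close>.
\<close>

lemma mean_diff_le_entropy:
  assumes \<mu>: "prob_space \<mu>" "sets \<mu> = sets \<Omega>"
    and D: "rel_entropy \<mu> \<nu> = ereal D"
    and f: "\<And>x y. x \<in> V \<rightarrow>\<^sub>E UNIV \<Longrightarrow> y \<in> V \<rightarrow>\<^sub>E UNIV \<Longrightarrow> \<bar>f x - f y\<bar> \<le> hamming V x y"
  shows "(\<integral>x. f x \<partial>\<mu>) - (\<integral>x. f x \<partial>\<nu>)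
    \<le> desc_gen_norm V E \<rho> b / real (card V) * sqrt (1 / 2 * D)"
proof -
  interpret \<mu>: prob_space \<mu> by (rule \<mu>)
  interpret \<nu>: prob_space \<nu> by (rule prob_\<nu>)
  define \<Delta> where "\<Delta> = desc_gen_norm V E \<rho> b"
  have \<Delta>: "0 < \<Delta>" using desc_gen_norm_pos by (simp add: \<Delta>_def)
  define n where "n = real (card V)"
  have n: "0 < n" using card_V_pos by (simp add: n_def)
  have f_lip: "coord_lipschitz V (\<lambda>_. 1 / n) f"
    using f by (simp add: coord_lipschitz_def hamming_def n_def sum_distrib_left)
  have f_meas: "f \<in> borel_measurable \<Omega>" by (rule coord_lipschitz_measurable[OF finite_V f_lip])
  have f_meas': "f \<in> borel_measurable \<mu>" "f \<in> borel_measurable \<nu>"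
    using f_meas by (simp_all add: measurable_cong_sets[OF \<mu>(2) HOL.refl] measurable_cong_sets[OF sets_\<nu> HOL.refl])
  have space: "space \<mu> = V \<rightarrow>\<^sub>E UNIV" "space \<nu> = V \<rightarrow>\<^sub>E UNIV"
    using sets_eq_imp_space_eq[OF \<mu>(2)] sets_eq_imp_space_eq[OF sets_\<nu>] by (simp_all add: space_PiM)
  obtain B where B: "\<And>x. x \<in> V \<rightarrow>\<^sub>E UNIV \<Longrightarrow> \<bar>f x\<bar> \<le> B"
    using coord_lipschitz_bounded[OF diam finite_V f_lip] n by auto
  have int_\<mu>: "integrable \<mu> f"
    using B f_meas'(1) by (intro \<mu>.integrable_const_bound[where B=B]) (auto simp: space)
  have int_\<nu>: "integrable \<nu> f"
    using B f_meas'(2) by (intro \<nu>.integrable_const_bound[where B=B]) (auto simp: space)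
  define m where "m = (\<integral>x. f x \<partial>\<nu>)"
  define d where "d = (\<integral>x. f x \<partial>\<mu>) - m"
  have mean_0: "(\<integral>x. f x - m \<partial>\<nu>) = 0" using int_\<nu> by (simp add: m_def \<nu>.prob_space)
  have gibbs: "n * t * d \<le> D + t\<^sup>2 * \<Delta>\<^sup>2 / 8" for t
  proof -
    have "ereal (\<integral>x. n * t * (f x - m) \<partial>\<mu>) \<le> rel_entropy \<mu> \<nu> + ereal (t\<^sup>2 * \<Delta>\<^sup>2 / 8)"
    proof (rule gibbs_variational_inequality[OF \<mu>(1) prob_\<nu>])
      show "(\<integral>\<^sup>+x. ennreal (exp (n * t * (f x - m))) \<partial>\<nu>) \<le> ennreal (exp (t\<^sup>2 * \<Delta>\<^sup>2 / 8))"
        unfolding n_def \<Delta>_def using f mean_0 by (intro exp_moment_hamming_lipschitz) auto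
    qed (use f_meas' int_\<mu> \<mu>(2) sets_\<nu> in auto)
    then show ?thesis using int_\<mu> by (simp add: D d_def \<mu>.prob_space)
  qed
  have D_nonneg: "0 \<le> D" using gibbs[of 0] by simp
  have "n * d \<le> \<Delta> * sqrt (1 / 2 * D)"
  proof (cases "D = 0")
    case True
    \<comment> \<open>No \<open>t\<close> is optimal here; the bound is the limit for \<open>t\<close> tending to \<open>0\<close>.\<close>
    have "n * d \<le> 0 + e" if e: "0 < e" for e
    proof -
      define t where "t = 8 * e / \<Delta>\<^sup>2"
      have t: "0 < t" using e \<Delta> by (simp add: t_def)
      have "t * (n * d) \<le> t * (t * \<Delta>\<^sup>2 / 8)"
        using gibbs[of t] True by (simp add: power2_eq_square mult_ac)
      then have "n * d \<le> t * \<Delta>\<^sup>2 / 8" using t by simp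
      then show ?thesis using \<Delta> by (simp add: t_def)
    qed
    then have "n * d \<le> 0" by (rule field_le_epsilon)
    then show ?thesis by (simp add: True)
  next
    case False
    define s where "s = sqrt (1 / 2 * D)"
    have s: "0 < s" "D = 2 * s\<^sup>2" using False D_nonneg by (simp_all add: s_def)
    \<comment> \<open>The minimiser of \<open>D / t + t * \<Delta>\<^sup>2 / 8\<close>.\<close>
    define t where "t = 4 * s / \<Delta>"
    have t: "0 < t" using s \<Delta> by (simp add: t_def)
    have "t * (n * d) \<le> D + t\<^sup>2 * \<Delta>\<^sup>2 / 8" using gibbs[of t] by (simp add: mult_ac)
    also have "\<dots> = t * (\<Delta> * s)"
      using \<Delta> by (simp add: s(2) t_def power_divide power_mult_distrib) (simp add: power2_eq_square)
    finally show ?thesis using t by (simp add: s_def)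
  qed
  then have "d \<le> \<Delta> * sqrt (1 / 2 * D) / n" using n by (simp add: pos_le_divide_eq mult.commute)
  then show ?thesis by (simp add: d_def m_def \<Delta>_def n_def)
qed

theorem transport_entropy:
  assumes \<mu>: "prob_space \<mu>" "sets \<mu> = sets \<Omega>" and D: "rel_entropy \<mu> \<nu> = ereal D"
  shows "transport_dist (hamming V) \<mu> \<nu>
    \<le> ennreal (desc_gen_norm V E \<rho> b / real (card V) * sqrt (1 / 2 * D))"
proof (rule config_space_simple_approx[OF finite_V])
  fix \<Phi> :: "nat \<Rightarrow> ('v \<Rightarrow> 'a) \<Rightarrow> 'v \<Rightarrow> 'a"
  assume \<Phi>: "\<And>n. simple_function \<Omega> (\<Phi> n)" "\<And>n x. \<Phi> n x \<in> V \<rightarrow>\<^sub>E UNIV"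
    "\<And>x v. v \<in> V \<Longrightarrow> (\<lambda>n. dist (x v) (\<Phi> n x v)) \<longlonglongrightarrow> 0"
  show ?thesis
  proof (rule kantorovich_duality[OF \<mu>(1) prob_\<nu> \<mu>(2) sets_\<nu>, where B=1 and \<Phi>=\<Phi>])
    show "(\<lambda>(x, y). hamming V x y) \<in> borel_measurable (\<Omega> \<Otimes>\<^sub>M \<Omega>)"
      unfolding hamming_def by measurable
    show "hamming V x z \<le> hamming V x y + hamming V y z" for x y z :: "'v \<Rightarrow> 'a"
    proof -
      have "(\<Sum>v\<in>V. dist (x v) (z v)) \<le> (\<Sum>v\<in>V. dist (x v) (y v)) + (\<Sum>v\<in>V. dist (y v) (z v))"
        unfolding sum.distrib[symmetric] by (intro sum_mono dist_triangle)
      then show ?thesis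
        unfolding hamming_def distrib_left[symmetric] by (intro mult_left_mono) auto
    qed
    show "hamming V x y \<le> 1" for x y :: "'v \<Rightarrow> 'a"
      using diam sum_bounded_above[of V "\<lambda>v. dist (x v) (y v)" 1] card_V_pos V_nonempty
      by (simp add: hamming_def divide_le_eq_1)
    show "(\<lambda>n. hamming V x (\<Phi> n x)) \<longlonglongrightarrow> 0" for x
      unfolding hamming_def by (intro tendsto_mult_right_zero tendsto_null_sum \<Phi>)
    fix f :: "('v \<Rightarrow> 'a) \<Rightarrow> real"
    assume "\<And>x y. x \<in> space \<Omega> \<Longrightarrow> y \<in> space \<Omega> \<Longrightarrow> \<bar>f x - f y\<bar> \<le> hamming V x y"
    then show "(\<integral>x. f x \<partial>\<mu>) - (\<integral>x. f x \<partial>\<nu>) \<le> desc_gen_norm V E \<rho> b / real (card V) * sqrt (1 / 2 * D)"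
      by (intro mean_diff_le_entropy[OF \<mu> D]) (simp add: space_PiM)
  qed (use \<Phi> in \<open>auto simp: space_PiM hamming_def dist_commute intro!: sum_nonneg divide_nonneg_nonneg\<close>)
qed

end

theorem theorem1:
  fixes V :: "'v set" and E :: "'v set set" and \<rho> :: 'v
    and \<nu>\<^sub>\<rho> :: "'a::polish_space measure" and q :: "'v \<Rightarrow> 'a \<Rightarrow> 'a measure"
    and \<nu> :: "('v \<Rightarrow> 'a) measure" and b :: real
  assumes diam: "\<And>x y :: 'a. dist x y \<le> 1"
    and tree: "finite_rooted_tree V E \<rho>"
    and b: "0 \<le> b" "b < 1"
    and markov: "markov_measure V E \<rho> \<nu>\<^sub>\<rho> q \<nu>"
    and lipschitz: "\<And>v. v \<in> V - {\<rho>} \<Longrightarrow> lipschitz_kernel b (q v)"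
  shows "(\<forall>(f :: ('v \<Rightarrow> 'a) \<Rightarrow> real) (t :: real).
            (\<forall>x\<in>V \<rightarrow>\<^sub>E UNIV. \<forall>y\<in>V \<rightarrow>\<^sub>E UNIV. \<bar>f x - f y\<bar> \<le> hamming V x y) \<longrightarrow>
            (\<integral>x. f x \<partial>\<nu>) = 0 \<longrightarrow>
            (\<integral>\<^sup>+ x. ennreal (exp (real (card V) * t * f x)) \<partial>\<nu>)
              \<le> ennreal (exp (t\<^sup>2 * (desc_gen_norm V E \<rho> b)\<^sup>2 / 8)))
       \<and> (\<forall>\<mu>\<in>space (prob_algebra (config_space V)).
            enn2ereal (transport_dist (hamming V) \<mu> \<nu>)
              \<le> ereal (desc_gen_norm V E \<rho> b / real (card V)) *
                 sqrt_ereal (1 / 2 * rel_entropy \<mu> \<nu>))"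
proof -
  interpret tree_markov V E \<rho> \<nu>\<^sub>\<rho> q \<nu> b
    using assms by unfold_locales
  have "enn2ereal (transport_dist (hamming V) \<mu> \<nu>)
      \<le> ereal (desc_gen_norm V E \<rho> b / real (card V)) * sqrt_ereal (1 / 2 * rel_entropy \<mu> \<nu>)"
    if "\<mu> \<in> space (prob_algebra (config_space V))" for \<mu>
  proof -
    have \<mu>: "prob_space \<mu>" "sets \<mu> = sets \<Omega>"
      using that by (simp_all add: space_prob_algebra)
    have pos: "0 < desc_gen_norm V E \<rho> b / real (card V)"
      using desc_gen_norm_pos card_V_pos by simp
    interpret \<nu>: prob_space \<nu> by (rule prob_\<nu>)
    have "ereal (\<integral>x. 0 \<partial>\<mu>) \<le> rel_entropy \<mu> \<nu> + ereal 0"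
      using \<mu> sets_\<nu> by (intro gibbs_variational_inequality prob_\<nu>) (simp_all add: \<nu>.emeasure_space_1)
    then have nonneg: "0 \<le> rel_entropy \<mu> \<nu>" by (simp add: zero_ereal_def[symmetric])
    show ?thesis
    proof (cases "rel_entropy \<mu> \<nu>")
      case (real D)
      then have D: "0 \<le> D" using nonneg by simp
      have half: "1 / 2 * rel_entropy \<mu> \<nu> = ereal (1 / 2 * D)"
        by (simp add: real one_ereal_def numeral_eq_ereal)
      have "0 \<le> desc_gen_norm V E \<rho> b / real (card V) * sqrt (1 / 2 * D)"
        using pos D by (intro mult_nonneg_nonneg) auto
      then have "enn2ereal (transport_dist (hamming V) \<mu> \<nu>)
          \<le> ereal (desc_gen_norm V E \<rho> b / real (card V) * sqrt (1 / 2 * D))"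
        using transport_entropy[OF \<mu> real] by (simp add: less_eq_ennreal.rep_eq enn2ereal_ennreal)
      then show ?thesis unfolding half by (simp add: sqrt_ereal_def)
    next
      case PInf
      have "1 / 2 * rel_entropy \<mu> \<nu> = \<infinity>"
        by (simp add: PInf one_ereal_def numeral_eq_ereal)
      then have "sqrt_ereal (1 / 2 * rel_entropy \<mu> \<nu>) = \<infinity>" by (simp add: sqrt_ereal_def)
      moreover have "y \<le> ereal K * S" if "0 < K" "S = \<infinity>" for y S and K :: real
        using that by simp
      ultimately show ?thesis using pos by blast
    next
      case MInf
      then show ?thesis using nonneg by simp
    qed
  qed
  then show ?thesis by (intro conjI allI impI ballI exp_moment_hamming_lipschitz) simp_all
qed

end
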